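(* Let $d \geq 2$ and let $s_{1},\ldots,s_{d} \geq 2$ be integers such that $s_{d} \geq \big((d-1)(s_{1}s_{2}\cdots s_{d-1}-1)\big)!+1$. Then there exist a constant $c>0$ (depending only on $d, s_1,\ldots,s_d$) and arbitrarily large integers $N$ such that there is a $d$-uniform hypergraph $\mathcal{H}$ with $|V(\mathcal{H})|=N$ that contains no copy of $K_{s_{1},\ldots,s_{d}}^{(d)}$ and satisfies $$|E(\mathcal{H})| \geq c\, N^{d-\frac{1}{s_{1}\cdots s_{d-1}}}.$$
   Context: $K_{s_{1},\ldots,s_{d}}^{(d)}$ denotes the complete $d$-partite $d$-uniform hypergraph with parts of sizes $s_1,\ldots,s_d$ (vertex sets $V_1,\ldots,V_d$ with $|V_i|=s_i$, and all $d$-sets containing exactly one vertex from each $V_i$ as hyperedges). The paper states the conclusion as $|E(\mathcal H)|=\Omega(N^{d-1/(s_1\cdots s_{d-1})})$. *)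

theory Defs
  imports Complex_Main
begin

type_synonym 'a hypergraph = "'a set \<times> 'a set set"

abbreviation hverts :: "'a hypergraph \<Rightarrow> 'a set" where
  "hverts H \<equiv> fst H"

abbreviation hedges :: "'a hypergraph \<Rightarrow> 'a set set" where
  "hedges H \<equiv> snd H"

definition uniform_hypergraph :: "nat \<Rightarrow> 'a hypergraph \<Rightarrow> bool" where
  "uniform_hypergraph d H \<longleftrightarrow>
     finite (hverts H) \<and> (\<forall>e\<in>hedges H. e \<subseteq> hverts H \<and> card e = d)"

(* The parts of K^(d)_{s_1,...,s_d} are realised as V_i = {i} x {0,...,s_i - 1} for 1 <= i <= d,
   which makes them pairwise disjoint with |V_i| = s_i. *)
definition K_part :: "(nat \<Rightarrow> nat) \<Rightarrow> nat \<Rightarrow> (nat \<times> nat) set" where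
  "K_part s i = {i} \<times> {..<s i}"

definition complete_partite :: "nat \<Rightarrow> (nat \<Rightarrow> nat) \<Rightarrow> (nat \<times> nat) hypergraph" where
  "complete_partite d s =
     (let V = (\<Union>i\<in>{1..d}. K_part s i)
      in (V, {e. e \<subseteq> V \<and> card e = d \<and> (\<forall>i\<in>{1..d}. card (e \<inter> K_part s i) = 1)}))"

(* A copy is a not necessarily induced sub-hypergraph isomorphic to K. *)
definition contains_copy :: "'a hypergraph \<Rightarrow> 'b hypergraph \<Rightarrow> bool" where
  "contains_copy H K \<longleftrightarrow>
     (\<exists>\<phi>. inj_on \<phi> (hverts K) \<and> \<phi> ` hverts K \<subseteq> hverts H \<and>
          (\<forall>e\<in>hedges K. \<phi> ` e \<in> hedges H))"

end

theory Submission
  imports Defs "HOL-Algebra.Algebraic_Closure_Type" "HOL-Library.Function_Algebras" "HOL-Library.Z2"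
begin

text \<open>
  Put \<open>t = s\<^sub>1 \<cdots> s\<^bsub>d-1\<^esub>\<close>, \<open>m = t - 1\<close> and \<open>D = d - 1\<close>. The hypergraph is \<open>d\<close>-partite; the vertices of part \<open>i\<close>
  are pairs \<open>(A, a)\<close> with \<open>A\<close> in a positive proportion of \<open>F = GF(q\<^sup>m)\<close> and \<open>a\<close> in \<open>GF(q)\<close> nonzero, and
  edges are given by \<open>N (1 + \<Sum>i. A\<^sub>i / (\<theta> + c\<^sub>i)) = \<Prod>i. a\<^sub>i\<close>, where \<open>N\<close> is the norm from the extension of
  degree \<open>D\<close> of \<open>F\<close> to \<open>GF(q)\<close>. Any \<open>d - 1\<close> of the elements \<open>1 / (\<theta> + c\<^sub>i)\<close> are independent over \<open>F\<close>, so
  distinct choices of vertices in \<open>d - 1\<close> parts yield distinct values of the linear form. The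
  common neighbours \<open>y\<close> of the \<open>t\<close> choices inside a copy thus satisfy a system of \<open>m + 1\<close> equations
  \<open>\<Prod>i<m. g i j (y\<^sub>i) = b\<close> in the conjugates \<open>y\<^sub>i\<close> of \<open>y\<close> and a common unknown \<open>b\<close>, with polynomials \<open>g i j\<close> of
  degree \<open>D\<close> that are coprime for distinct \<open>j\<close>.

  Such a system has at most \<open>m! D\<^sup>m\<close> solutions. Write \<open>f\<^sub>j = \<Prod>i. g i j\<close> and let \<open>M\<^sub>r\<close> be the space of
  polynomials of degree at most \<open>D r\<close> in each of the \<open>m\<close> variables. Coprimality gives
  \<open>M\<^bsub>r+1\<^esub> = \<Sum>j. f\<^sub>j M\<^sub>r\<close> for \<open>r \<ge> m\<close>. As \<open>f\<^sub>j - f\<^sub>0\<close> vanishes at the solutions, modulo functions vanishing there to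
  order \<open>L\<close> every polynomial is a power of \<open>f\<^sub>0\<close> times an element of \<open>M\<^bsub>m+L\<^esub>\<close>. Comparing dimensions, \<open>n\<close> solutions
  give \<open>n * ((L - 1 + m) choose m) \<le> (D (m + L) + 1)\<^sup>m\<close>, and \<open>L \<rightarrow> \<infinity>\<close> yields the bound. Finally
  \<open>m! D\<^sup>m \<le> (D m)! < s\<^sub>d\<close>.
\<close>

section \<open>Product systems of polynomial equations\<close>

text \<open>As simp rules these unfold pointwise sums and products of functions even where the functions
  occur as set elements.\<close>

declare plus_fun_apply [simp del] times_fun_apply [simp del]
  zero_fun_apply [simp del] one_fun_apply [simp del]

section \<open>Linear algebra in spaces of functions\<close>

definition fscale :: "'a::field \<Rightarrow> ('b \<Rightarrow> 'a) \<Rightarrow> 'b \<Rightarrow> 'a" where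
  "fscale c f = (\<lambda>x. c * f x)"

interpretation fv: vector_space fscale
  by unfold_locales (auto simp: fscale_def fun_eq_iff plus_fun_apply algebra_simps)

lemma fscale_apply: "fscale c f x = c * f x"
  by (simp add: fscale_def)

lemma sum_fun_apply: "sum f A x = (\<Sum>a\<in>A. f a x)"
  by (induction A rule: infinite_finite_induct) (auto simp: plus_fun_apply zero_fun_apply)

lemmas fun_apply = plus_fun_apply times_fun_apply zero_fun_apply one_fun_apply
  fscale_apply sum_fun_apply

lemma mult_span_in_subspace:
  assumes "f \<in> fv.span A" "fv.subspace S" "\<And>a. a \<in> A \<Longrightarrow> h * a \<in> S"
  shows "h * f \<in> S"
  using assms(1)
proof (induction rule: fv.span_induct_alt)
  case base
  show ?case
    unfolding mult_zero_right by (rule fv.subspace_0[OF assms(2)])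
next
  case (step c x y)
  have eq: "h * (fscale c x + y) = fscale c (h * x) + h * y"
    by (auto simp: fun_eq_iff fun_apply algebra_simps)
  show ?case
    unfolding eq by (intro fv.subspace_add[OF assms(2)] fv.subspace_scale[OF assms(2)] assms(3) step)
qed

text \<open>Any relation among the approximants \<open>v i\<close> is a relation among the
  \<open>u i\<close> modulo \<open>V\<close>, so the \<open>v i\<close> are independent inside the
  span of \<open>B\<close>. This compares dimensions in the quotient by \<open>V\<close> without
  forming the quotient.\<close>

lemma card_le_if_independent_modulo:
  assumes "finite I" "finite B" "fv.subspace V"
    and split: "\<And>i. i \<in> I \<Longrightarrow> \<exists>v\<in>fv.span B. u i - v \<in> V"
    and indep: "\<And>c. (\<Sum>i\<in>I. fscale (c i) (u i)) \<in> V \<Longrightarrow> \<forall>i\<in>I. c i = 0"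
  shows "card I \<le> card B"
proof -
  obtain v where v: "\<And>i. i \<in> I \<Longrightarrow> v i \<in> fv.span B" "\<And>i. i \<in> I \<Longrightarrow> u i - v i \<in> V"
    using split by metis
  have zero: "\<forall>i\<in>I. c i = 0" if "(\<Sum>i\<in>I. fscale (c i) (v i)) = 0" for c
  proof (rule indep)
    have "(\<Sum>i\<in>I. fscale (c i) (u i)) = (\<Sum>i\<in>I. fscale (c i) (u i)) - (\<Sum>i\<in>I. fscale (c i) (v i))"
      using that by simp
    also have "\<dots> = (\<Sum>i\<in>I. fscale (c i) (u i - v i))"
      by (simp add: fv.scale_right_diff_distrib sum_subtractf)
    also have "\<dots> \<in> V"
      using v(2) assms(3) by (intro fv.subspace_sum fv.subspace_scale) auto
    finally show "(\<Sum>i\<in>I. fscale (c i) (u i)) \<in> V" .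
  qed
  have inj: "inj_on v I"
  proof (rule inj_onI, rule ccontr)
    fix i j assume ij: "i \<in> I" "j \<in> I" "v i = v j" "i \<noteq> j"
    let ?c = "\<lambda>k. if k = i then 1 else if k = j then - 1 else 0"
    have "(\<Sum>k\<in>I. fscale (?c k) (v k)) = (\<Sum>k\<in>{i, j}. fscale (?c k) (v k))"
      using ij assms(1) by (intro sum.mono_neutral_right) auto
    also have "\<dots> = 0"
      using ij by simp
    finally show False
      using zero[of ?c] ij(1) by auto
  qed
  have "\<not> fv.dependent (v ` I)"
  proof (rule fv.independent_if_scalars_zero)
    show "finite (v ` I)" using assms(1) by simp
    fix f x assume *: "(\<Sum>x\<in>v ` I. fscale (f x) x) = 0" "x \<in> v ` I"
    have "(\<Sum>i\<in>I. fscale (f (v i)) (v i)) = 0"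
      using * inj by (simp add: sum.reindex)
    from zero[OF this] * show "f x = 0" by auto
  qed
  then have "card (v ` I) \<le> card B"
    using fv.independent_span_bound[OF assms(2)] v(1) by blast
  then show ?thesis
    using inj by (simp add: card_image)
qed

section \<open>Polynomial functions of bounded degree in each variable\<close>

definition tens :: "nat \<Rightarrow> (nat \<Rightarrow> 'a::field poly) \<Rightarrow> (nat \<Rightarrow> 'a) \<Rightarrow> 'a" where
  "tens m p = (\<lambda>y. \<Prod>i<m. poly (p i) (y i))"

text \<open>\<open>tens m p\<close> only depends on the coordinates below \<open>m\<close>; \<open>box m n\<close> consists of the polynomial
  functions in \<open>m\<close> variables of degree at most \<open>n\<close> in each of them.\<close>

definition box :: "nat \<Rightarrow> nat \<Rightarrow> ((nat \<Rightarrow> 'a::field) \<Rightarrow> 'a) set" where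
  "box m n = fv.span {tens m p | p. \<forall>i<m. degree (p i) \<le> n}"

lemma subspace_box: "fv.subspace (box m n)"
  by (simp add: box_def)

lemma box_mono: "n \<le> n' \<Longrightarrow> box m n \<subseteq> box m n'"
  unfolding box_def by (intro fv.span_mono) (blast intro: order.trans)

lemma tens_in_box: "(\<And>i. i < m \<Longrightarrow> degree (p i) \<le> n) \<Longrightarrow> tens m p \<in> box m n"
  unfolding box_def by (rule fv.span_base) auto

lemma tens_mult: "tens m p * tens m p' = tens m (\<lambda>i. p i * p' i)"
  by (simp add: tens_def fun_eq_iff fun_apply prod.distrib)

lemma tens_mult_in_box:
  fixes p :: "nat \<Rightarrow> 'a::field poly"
  assumes "\<And>i. i < m \<Longrightarrow> degree (p i) \<le> a" "f \<in> box m b"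
  shows "tens m p * f \<in> box m (a + b)"
  using assms(2) unfolding box_def[of m b]
proof (rule mult_span_in_subspace)
  fix x :: "(nat \<Rightarrow> 'a) \<Rightarrow> 'a" assume "x \<in> {tens m p |p. \<forall>i<m. degree (p i) \<le> b}"
  then obtain p' where p': "x = tens m p'" "\<forall>i<m. degree (p' i) \<le> b" by auto
  show "tens m p * x \<in> box m (a + b)"
    unfolding p'(1) tens_mult
    by (intro tens_in_box order.trans[OF degree_mult_le] add_mono) (use assms p' in auto)
qed (rule subspace_box)

lemma box_subset_span_monomials:
  "\<exists>B. finite B \<and> card B \<le> (n + 1) ^ m \<and> box m n \<subseteq> fv.span B"
proof -
  let ?mon = "\<lambda>b :: nat \<Rightarrow> nat. \<lambda>y :: nat \<Rightarrow> 'a. \<Prod>i<m. y i ^ b i"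
  let ?I = "{..<m} \<rightarrow>\<^sub>E {..n}"
  have "tens m p \<in> fv.span (?mon ` ?I)" if p: "\<forall>i<m. degree (p i) \<le> n" for p
  proof -
    have "tens m p = (\<lambda>y. \<Prod>i<m. \<Sum>j\<le>n. coeff (p i) j * y i ^ j)"
      unfolding tens_def
    proof (intro ext prod.cong refl)
      fix y :: "nat \<Rightarrow> 'a" and i assume "i \<in> {..<m}"
      then show "poly (p i) (y i) = (\<Sum>j\<le>n. coeff (p i) j * y i ^ j)"
        unfolding poly_altdef using p
        by (intro sum.mono_neutral_left) (auto simp: coeff_eq_0)
    qed
    also have "\<dots> = (\<Sum>b\<in>?I. fscale (\<Prod>i<m. coeff (p i) (b i)) (?mon b))"
      by (auto simp: prod_sum_PiE fun_eq_iff fun_apply prod.distrib)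
    also have "\<dots> \<in> fv.span (?mon ` ?I)"
      by (intro fv.span_sum fv.span_scale fv.span_base) auto
    finally show ?thesis .
  qed
  then have "box m n \<subseteq> fv.span (?mon ` ?I)"
    unfolding box_def by (intro fv.span_minimal) auto
  moreover have "finite (?mon ` ?I)"
    by (intro finite_imageI finite_PiE) auto
  moreover have "card (?mon ` ?I) \<le> (n + 1) ^ m"
    by (rule order.trans[OF card_image_le]) (auto simp: card_PiE intro: finite_PiE)
  ultimately show ?thesis by blast
qed

section \<open>Partial fractions with degree control\<close>

text \<open>Bezout's identity for several pairwise coprime polynomials. To add \<open>a\<close>,
  take \<open>u * g a + v * prod g J = 1\<close> and multiply the identity for \<open>J\<close> by
  \<open>u * g a\<close>; the remaining \<open>v * prod g J\<close> is the term of the new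
  index.\<close>

lemma sum_prod_except_eq_1:
  fixes g :: "'i \<Rightarrow> 'a::field_gcd poly"
  assumes "finite J" "J \<noteq> {}" "\<And>i j. i \<in> J \<Longrightarrow> j \<in> J \<Longrightarrow> i \<noteq> j \<Longrightarrow> coprime (g i) (g j)"
  shows "\<exists>w. (\<Sum>j\<in>J. w j * prod g (J - {j})) = 1"
  using assms
proof (induction J rule: finite_ne_induct)
  case (singleton x)
  then show ?case by auto
next
  case (insert a J)
  obtain w where w: "(\<Sum>j\<in>J. w j * prod g (J - {j})) = 1"
    using insert.IH insert.prems by auto
  have "coprime (g a) (prod g J)"
    using insert by (intro prod_coprime_right) auto
  then obtain u v where uv: "u * g a + v * prod g J = 1"
    using bezout_coefficients_fst_snd[of "g a" "prod g J"] by (metis coprime_imp_gcd_eq_1)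
  let ?w = "\<lambda>j. if j = a then v else u * w j"
  have "(\<Sum>j\<in>insert a J. ?w j * prod g (insert a J - {j}))
    = v * prod g J + (\<Sum>j\<in>J. ?w j * prod g (insert a J - {j}))"
    using insert by (simp add: insert_Diff_if)
  also have "(\<Sum>j\<in>J. ?w j * prod g (insert a J - {j})) = (\<Sum>j\<in>J. u * g a * (w j * prod g (J - {j})))"
  proof (rule sum.cong, simp)
    fix j assume j: "j \<in> J"
    then have "insert a J - {j} = insert a (J - {j})" "j \<noteq> a" using insert by auto
    then show "?w j * prod g (insert a J - {j}) = u * g a * (w j * prod g (J - {j}))"
      using insert by (simp add: ac_simps)
  qed
  also have "v * prod g J + \<dots> = 1"
    using w uv by (simp add: sum_distrib_left[symmetric] add.commute)
  finally show ?case by (intro exI[of _ ?w])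
qed

text \<open>For \<open>j > 0\<close> the numerators are reduced modulo \<open>g j\<close>, and all
  quotients are moved into the term \<open>j = 0\<close>. That term is then \<open>p\<close> minus
  terms of degree at most \<open>D * (m + 1)\<close>, so its degree is bounded as well.\<close>

lemma partial_fractions_degree:
  fixes g :: "nat \<Rightarrow> 'a::field_gcd poly"
  assumes cop: "\<And>i j. i \<le> m \<Longrightarrow> j \<le> m \<Longrightarrow> i \<noteq> j \<Longrightarrow> coprime (g i) (g j)"
    and deg: "\<And>j. j \<le> m \<Longrightarrow> degree (g j) = D" and "D > 0"
    and "degree p \<le> N" "D * (m + 1) \<le> N"
  shows "\<exists>w. (\<Sum>j\<le>m. w j * prod g ({..m} - {j})) = p \<and>
    (\<forall>j\<le>m. degree (w j * prod g ({..m} - {j})) \<le> N)"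
proof -
  let ?G = "\<lambda>j. prod g ({..m} - {j})"
  obtain w where w: "(\<Sum>j\<le>m. w j * ?G j) = 1"
    using sum_prod_except_eq_1[of "{..m}" g] cop by auto
  define q where "q j = (p * w j) div g j" for j
  define r where "r j = (p * w j) mod g j" for j
  have G: "g j * ?G j = prod g {..m}" if "j \<le> m" for j
    using that by (simp add: prod.remove[of "{..m}" j])
  have small: "degree (r j * ?G j) \<le> N" if "j \<le> m" for j
  proof -
    have "degree (r j) \<le> D"
      using degree_mod_less[of "g j" "p * w j"] deg[OF that] \<open>D > 0\<close> by (cases "g j = 0") (auto simp: r_def)
    moreover have "degree (?G j) \<le> D * m"
      by (rule order.trans[OF degree_prod_sum_le]) (use that deg in auto)
    ultimately have "degree (r j * ?G j) \<le> D + D * m"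
      by (intro order.trans[OF degree_mult_le] add_mono)
    then show ?thesis using assms(5) by simp
  qed
  define w' where "w' j = (if j = 0 then p * w 0 + g 0 * (\<Sum>j=1..m. q j) else r j)" for j
  have set: "{..m} = insert 0 {1..m}" by auto
  have "p = p * (\<Sum>j\<le>m. w j * ?G j)"
    using w by simp
  also have "\<dots> = (\<Sum>j\<le>m. (p * w j) * ?G j)"
    by (simp add: sum_distrib_left mult.assoc)
  also have "\<dots> = p * w 0 * ?G 0 + (\<Sum>j=1..m. (q j * g j + r j) * ?G j)"
    by (subst set, subst sum.insert) (auto simp: q_def r_def)
  also have "(\<Sum>j=1..m. (q j * g j + r j) * ?G j) = (\<Sum>j=1..m. q j * (g 0 * ?G 0) + r j * ?G j)"
    by (rule sum.cong) (auto simp: algebra_simps G)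
  also have "p * w 0 * ?G 0 + \<dots> = w' 0 * ?G 0 + (\<Sum>j=1..m. w' j * ?G j)"
    by (simp add: w'_def sum.distrib algebra_simps sum_distrib_left sum_distrib_right)
  finally have p: "p = w' 0 * ?G 0 + (\<Sum>j=1..m. w' j * ?G j)" .
  moreover have "(\<Sum>j=1..m. w' j * ?G j) = (\<Sum>j=1..m. r j * ?G j)"
    by (rule sum.cong) (auto simp: w'_def)
  ultimately have "w' 0 * ?G 0 = p - (\<Sum>j=1..m. r j * ?G j)"
    by simp
  then have "degree (w' 0 * ?G 0) = degree (p - (\<Sum>j=1..m. r j * ?G j))"
    by simp
  also have "\<dots> \<le> N"
    using small assms(4) by (intro degree_diff_le degree_sum_le) auto
  finally have "degree (w' 0 * ?G 0) \<le> N" .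
  then have "\<forall>j\<le>m. degree (w' j * ?G j) \<le> N"
    using small by (auto simp: w'_def)
  moreover have "(\<Sum>j\<le>m. w' j * ?G j) = p"
    by (subst set, subst sum.insert) (use p in auto)
  ultimately show ?thesis by blast
qed

text \<open>Expand every factor \<open>p i\<close> by partial fractions with respect to \<open>g i 0, \<dots>, g i m\<close>. Each term of
  the expanded product omits only \<open>m\<close> of the \<open>m + 1\<close> indices \<open>j\<close>, one per variable, hence is divisible
  by some \<open>\<Prod>i. g i j\<close>.\<close>

lemma box_step:
  fixes g :: "nat \<Rightarrow> nat \<Rightarrow> 'a::field_gcd poly"
  assumes cop: "\<And>i j j'. i < m \<Longrightarrow> j \<le> m \<Longrightarrow> j' \<le> m \<Longrightarrow> j \<noteq> j' \<Longrightarrow> coprime (g i j) (g i j')"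
    and deg: "\<And>i j. i < m \<Longrightarrow> j \<le> m \<Longrightarrow> degree (g i j) = D" and "D > 0" "m \<le> r"
  shows "box m (D * (r + 1)) \<subseteq> fv.span (\<Union>j\<le>m. (\<lambda>f. tens m (\<lambda>i. g i j) * f) ` box m (D * r))"
    (is "_ \<subseteq> fv.span ?R")
proof -
  have "tens m p \<in> fv.span ?R" if p: "\<forall>i<m. degree (p i) \<le> D * (r + 1)" for p
  proof -
    let ?G = "\<lambda>i j. prod (g i) ({..m} - {j})"
    have "\<exists>w. (\<Sum>j\<le>m. w j * ?G i j) = p i \<and> (\<forall>j\<le>m. degree (w j * ?G i j) \<le> D * (r + 1))"
      if "i < m" for i
    proof (rule partial_fractions_degree)
      show "D * (m + 1) \<le> D * (r + 1)"
        using \<open>m \<le> r\<close> by simp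
    qed (use that assms p in blast)+
    then have "\<forall>i. \<exists>w. i < m \<longrightarrow> (\<Sum>j\<le>m. w j * ?G i j) = p i \<and>
        (\<forall>j\<le>m. degree (w j * ?G i j) \<le> D * (r + 1))"
      by blast
    from choice[OF this] obtain w where w: "\<And>i. i < m \<Longrightarrow> (\<Sum>j\<le>m. w i j * ?G i j) = p i"
      "\<And>i j. i < m \<Longrightarrow> j \<le> m \<Longrightarrow> degree (w i j * ?G i j) \<le> D * (r + 1)"
      by blast
    let ?I = "{..<m} \<rightarrow>\<^sub>E {..m}"
    have "tens m p = (\<lambda>y. \<Prod>i<m. \<Sum>j\<le>m. poly (w i j * ?G i j) (y i))"
      unfolding tens_def poly_sum[symmetric] by (intro ext prod.cong) (simp_all add: w(1))
    also have "\<dots> = (\<Sum>c\<in>?I. tens m (\<lambda>i. w i (c i) * ?G i (c i)))"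
      by (simp add: prod_sum_PiE fun_eq_iff fun_apply tens_def)
    also have "\<dots> \<in> fv.span ?R"
    proof (rule fv.span_sum)
      fix c assume c: "c \<in> ?I"
      have "card (c ` {..<m}) < card {..m}"
        using card_image_le[of "{..<m}" c] by simp
      then obtain j where j: "j \<le> m" "j \<notin> c ` {..<m}"
        by (metis atMost_iff card_mono finite_imageI finite_lessThan leD subsetI)
      define k where "k i = w i (c i) * prod (g i) ({..m} - {c i} - {j})" for i
      have eq: "w i (c i) * ?G i (c i) = g i j * k i" if "i < m" for i
        using j that by (subst prod.remove[of "{..m} - {c i}" j]) (auto simp: k_def)
      have "degree (k i) \<le> D * r" if i: "i < m" for i
      proof (cases "k i = 0")
        case False
        have "D + degree (k i) = degree (g i j * k i)"
          using False i j deg[of i j] \<open>D > 0\<close> by (subst degree_mult_eq) auto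
        also have "\<dots> \<le> D * (r + 1)"
          using w(2)[OF i, of "c i"] c i eq[OF i] by (auto simp: PiE_def)
        finally show ?thesis by simp
      qed auto
      then have "tens m k \<in> box m (D * r)"
        by (intro tens_in_box)
      moreover have "tens m (\<lambda>i. w i (c i) * ?G i (c i)) = tens m (\<lambda>i. g i j) * tens m k"
        unfolding tens_mult unfolding tens_def using eq by auto
      ultimately show "tens m (\<lambda>i. w i (c i) * ?G i (c i)) \<in> fv.span ?R"
        using j by (intro fv.span_base) auto
    qed
    finally show ?thesis .
  qed
  then show ?thesis
    unfolding box_def[of m "D * (r + 1)"] by (intro fv.span_minimal) auto
qed

section \<open>Vanishing order at points\<close>

text \<open>Vanishing order is tested along all lines through the points, which avoids derivatives and is
  therefore insensitive to the characteristic.\<close>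

definition vanish :: "(nat \<Rightarrow> 'a::field) set \<Rightarrow> nat \<Rightarrow> ((nat \<Rightarrow> 'a) \<Rightarrow> 'a) set" where
  "vanish S l = {f. \<forall>P\<in>S. \<forall>v. \<exists>h. \<forall>\<tau>. f (\<lambda>i. P i + \<tau> * v i) = \<tau> ^ l * poly h \<tau>}"

lemma subspace_vanish: "fv.subspace (vanish S l)"
proof (rule fv.subspaceI)
  show "0 \<in> vanish S l"
    by (auto simp: vanish_def fun_apply intro: exI[of _ 0])
next
  fix f f' assume ff': "f \<in> vanish S l" "f' \<in> vanish S l"
  show "f + f' \<in> vanish S l"
    unfolding vanish_def
  proof safe
    fix P v assume "P \<in> S"
    then obtain h h' where "\<forall>\<tau>. f (\<lambda>i. P i + \<tau> * v i) = \<tau> ^ l * poly h \<tau>"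
      "\<forall>\<tau>. f' (\<lambda>i. P i + \<tau> * v i) = \<tau> ^ l * poly h' \<tau>"
      using ff' unfolding vanish_def by blast
    then show "\<exists>h. \<forall>\<tau>. (f + f') (\<lambda>i. P i + \<tau> * v i) = \<tau> ^ l * poly h \<tau>"
      by (intro exI[of _ "h + h'"]) (simp add: fun_apply algebra_simps)
  qed
next
  fix c f assume f: "f \<in> vanish S l"
  show "fscale c f \<in> vanish S l"
    unfolding vanish_def
  proof safe
    fix P v assume "P \<in> S"
    then obtain h where "\<forall>\<tau>. f (\<lambda>i. P i + \<tau> * v i) = \<tau> ^ l * poly h \<tau>"
      using f unfolding vanish_def by blast
    then show "\<exists>h. \<forall>\<tau>. fscale c f (\<lambda>i. P i + \<tau> * v i) = \<tau> ^ l * poly h \<tau>"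
      by (intro exI[of _ "smult c h"]) (simp add: fun_apply algebra_simps)
  qed
qed

lemma vanish_mult:
  assumes "f \<in> vanish S a" "f' \<in> vanish S b"
  shows "f * f' \<in> vanish S (a + b)"
  unfolding vanish_def
proof safe
  fix P v assume "P \<in> S"
  then obtain h h' where "\<forall>\<tau>. f (\<lambda>i. P i + \<tau> * v i) = \<tau> ^ a * poly h \<tau>"
    "\<forall>\<tau>. f' (\<lambda>i. P i + \<tau> * v i) = \<tau> ^ b * poly h' \<tau>"
    using assms unfolding vanish_def by blast
  then show "\<exists>h. \<forall>\<tau>. (f * f') (\<lambda>i. P i + \<tau> * v i) = \<tau> ^ (a + b) * poly h \<tau>"
    by (intro exI[of _ "h * h'"]) (simp add: fun_apply algebra_simps power_add)
qed

lemma vanish_antimono: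
  assumes "f \<in> vanish S b" "a \<le> b"
  shows "f \<in> vanish S a"
  unfolding vanish_def
proof safe
  fix P v assume "P \<in> S"
  then obtain h where h: "\<forall>\<tau>. f (\<lambda>i. P i + \<tau> * v i) = \<tau> ^ b * poly h \<tau>"
    using assms unfolding vanish_def by blast
  have "b = a + (b - a)" using assms by simp
  then have "\<tau> ^ b = \<tau> ^ a * \<tau> ^ (b - a)" for \<tau> :: 'a
    by (metis power_add)
  then show "\<exists>h. \<forall>\<tau>. f (\<lambda>i. P i + \<tau> * v i) = \<tau> ^ a * poly h \<tau>"
    using h by (intro exI[of _ "Polynomial.monom 1 (b - a) * h"]) (simp add: poly_monom mult.assoc)
qed

lemma box_subset_vanish_0: "box m n \<subseteq> vanish S 0"
  unfolding box_def
proof (intro fv.span_minimal subspace_vanish, safe)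
  fix p :: "nat \<Rightarrow> 'a poly"
  show "tens m p \<in> vanish S 0"
    unfolding vanish_def
  proof safe
    fix P v
    show "\<exists>h. \<forall>\<tau>. tens m p (\<lambda>i. P i + \<tau> * v i) = \<tau> ^ 0 * poly h \<tau>"
      by (intro exI[of _ "\<Prod>i<m. pcompose (p i) [:P i, v i:]"])
        (auto simp: tens_def poly_prod poly_pcompose)
  qed
qed

lemma vanish_1I:
  assumes "f \<in> vanish S 0" "\<And>P. P \<in> S \<Longrightarrow> f P = 0"
  shows "f \<in> vanish S 1"
  unfolding vanish_def
proof safe
  fix P v assume P: "P \<in> S"
  then obtain h where "\<forall>\<tau>. f (\<lambda>i. P i + \<tau> * v i) = \<tau> ^ 0 * poly h \<tau>"
    using assms(1) unfolding vanish_def by blast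
  then have h: "\<forall>\<tau>. f (\<lambda>i. P i + \<tau> * v i) = poly h \<tau>"
    by simp
  have "poly h 0 = 0"
    using h[rule_format, of 0] assms(2)[OF P] by simp
  then obtain k where "h = [:0, 1:] * k"
    using poly_eq_0_iff_dvd[of h 0] by (auto elim: dvdE)
  then show "\<exists>h. \<forall>\<tau>. f (\<lambda>i. P i + \<tau> * v i) = \<tau> ^ 1 * poly h \<tau>"
    using h by (intro exI[of _ k]) simp
qed

section \<open>Polynomial functions determine their coefficients\<close>

lemma digits_unique:
  fixes a b :: "nat \<Rightarrow> nat"
  assumes "(\<Sum>i<m. a i * L ^ i) = (\<Sum>i<m. b i * L ^ i)"
    and "\<And>i. i < m \<Longrightarrow> a i < L" "\<And>i. i < m \<Longrightarrow> b i < L"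
  shows "\<forall>i<m. a i = b i"
  using assms
proof (induction m arbitrary: a b)
  case (Suc m)
  have split: "(\<Sum>i<Suc m. c i * L ^ i) = c 0 + L * (\<Sum>i<m. c (Suc i) * L ^ i)" for c :: "nat \<Rightarrow> nat"
    by (subst sum.lessThan_Suc_shift) (simp add: sum_distrib_left ac_simps)
  have eq: "a 0 + L * (\<Sum>i<m. a (Suc i) * L ^ i) = b 0 + L * (\<Sum>i<m. b (Suc i) * L ^ i)"
    using Suc.prems(1) unfolding split .
  have lt: "a 0 < L" "b 0 < L" using Suc.prems(2,3)[of 0] by auto
  have "a 0 = b 0"
    using arg_cong[OF eq, of "\<lambda>x. x mod L"] lt by simp
  moreover have "\<forall>i<m. a (Suc i) = b (Suc i)"
    using Suc.IH[of "\<lambda>i. a (Suc i)" "\<lambda>i. b (Suc i)"] Suc.prems eq \<open>a 0 = b 0\<close> lt by auto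
  ultimately show ?case
    by (auto simp: less_Suc_eq_0_disj)
qed simp

lemma finite_lists_sum_eq: "finite {l::nat list. length l = n \<and> sum_list l = N}"
proof (rule finite_subset)
  show "{l. length l = n \<and> sum_list l = N} \<subseteq> {l. set l \<subseteq> {..N} \<and> length l = n}"
    using member_le_sum_list by fastforce
qed (simp add: finite_lists_length_eq)

lemma coeffs_zero_if_poly_function_zero:
  fixes c :: "nat list \<Rightarrow> 'a::field"
  assumes inf: "infinite (UNIV :: 'a set)"
    and A: "A = {l. length l = m + 1 \<and> sum_list l = N}"
    and zero: "\<And>v :: nat \<Rightarrow> 'a. (\<Sum>l\<in>A. c l * (\<Prod>i<m. v i ^ (l ! i))) = 0"
    and "l \<in> A"
  shows "c l = 0"
proof -
  have finA: "finite A"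
    unfolding A by (rule finite_lists_sum_eq)
  \<comment> \<open>Kronecker substitution; the last entry of \<open>l\<close> is determined by the others.\<close>
  let ?k = "\<lambda>l. \<Sum>i<m. l ! i * (N + 1) ^ i"
  have inj: "l = l'" if "l \<in> A" "l' \<in> A" "?k l = ?k l'" for l l'
  proof (rule nth_equalityI)
    have small: "x ! i < N + 1" if "x \<in> A" "i < m" for x i
      using that member_le_sum_list[of "x ! i" x] by (auto simp: A less_Suc_eq_le)
    have eq: "\<forall>i<m. l ! i = l' ! i"
      using digits_unique[OF that(3)] small that by blast
    have "sum_list x = (\<Sum>i<m. x ! i) + x ! m" if "x \<in> A" for x
      using that by (simp add: A sum_list_sum_nth atLeast0LessThan)
    from this[OF that(1)] this[OF that(2)] have "l ! m = l' ! m"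
      using that(1,2) eq by (simp add: A)
    then show "\<And>i. i < length l \<Longrightarrow> l ! i = l' ! i"
      using eq that by (auto simp: A less_Suc_eq)
  qed (use that in \<open>simp add: A\<close>)
  let ?p = "\<Sum>l\<in>A. Polynomial.monom (c l) (?k l)"
  have "poly ?p w = 0" for w
    using zero[of "\<lambda>i. w ^ (N + 1) ^ i"]
    by (simp add: poly_sum poly_monom power_sum power_mult[symmetric] mult.commute)
  then have "{w. poly ?p w = 0} = UNIV"
    by auto
  then have "?p = 0"
    using poly_roots_finite[of ?p] inf by metis
  then have "0 = coeff ?p (?k l)"
    by simp
  also have "\<dots> = (\<Sum>l'\<in>A. if l' = l then c l' else 0)"
    unfolding coeff_sum using inj \<open>l \<in> A\<close> by (intro sum.cong) auto
  finally show ?thesis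
    using finA \<open>l \<in> A\<close> by simp
qed

section \<open>The number of solutions of a product system\<close>

text \<open>The unknown common value of the products is eliminated by comparing each product with
  that of index 0. Since coordinate 0 is injective on \<open>S\<close>, polynomials in that single
  coordinate can separate the points.\<close>

locale product_system =
  fixes m D :: nat and g :: "nat \<Rightarrow> nat \<Rightarrow> 'a::field_gcd poly" and S :: "(nat \<Rightarrow> 'a) set"
  assumes m_pos: "m > 0" and D_pos: "D > 0"
    and coprime: "\<And>i j j'. i < m \<Longrightarrow> j \<le> m \<Longrightarrow> j' \<le> m \<Longrightarrow> j \<noteq> j' \<Longrightarrow> coprime (g i j) (g i j')"
    and degree: "\<And>i j. i < m \<Longrightarrow> j \<le> m \<Longrightarrow> Polynomial.degree (g i j) = D"
    and finite_S: "finite S"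
    and inj: "inj_on (\<lambda>P. P 0) S"
    and solution: "\<And>P j. P \<in> S \<Longrightarrow> j \<le> m \<Longrightarrow>
      (\<Prod>i<m. poly (g i j) (P i)) = (\<Prod>i<m. poly (g i 0) (P i))"
    and infinite_UNIV: "infinite (UNIV :: 'a set)"
begin

definition F :: "nat \<Rightarrow> (nat \<Rightarrow> 'a) \<Rightarrow> 'a" where
  "F j = tens m (\<lambda>i. g i j)"

lemma F_mult_in_box: "j \<le> m \<Longrightarrow> f \<in> box m (D * n) \<Longrightarrow> F j * f \<in> box m (D * Suc n)"
  using tens_mult_in_box[of m "\<lambda>i. g i j" D f "D * n"] degree by (simp add: F_def)

lemma F_power_mult_in_box: "f \<in> box m (D * n) \<Longrightarrow> F 0 ^ k * f \<in> box m (D * (n + k))"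
proof (induction k)
  case (Suc k)
  then show ?case
    using F_mult_in_box[of 0 "F 0 ^ k * f" "n + k"] by (simp add: mult.assoc)
qed simp

lemma F_in_vanish: "F j \<in> vanish S 0"
proof -
  have "F j \<in> box m (\<Sum>i<m. Polynomial.degree (g i j))"
    unfolding F_def by (intro tens_in_box member_le_sum) auto
  then show ?thesis
    using box_subset_vanish_0 by blast
qed

lemma F_power_in_vanish: "F 0 ^ k \<in> vanish S 0"
proof (induction k)
  case 0
  show ?case
    by (auto simp: vanish_def fun_apply intro: exI[of _ 1])
next
  case (Suc k)
  then show ?case
    using vanish_mult[OF F_in_vanish[of 0] Suc] by simp
qed

lemma F_diff_in_vanish:
  assumes "j \<le> m"
  shows "F j - F 0 \<in> vanish S 1"
proof (rule vanish_1I)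
  show "F j - F 0 \<in> vanish S 0"
    using subspace_vanish F_in_vanish F_in_vanish by (rule fv.subspace_diff)
  show "(F j - F 0) P = 0" if "P \<in> S" for P
    using solution[OF that assms] by (simp add: F_def tens_def)
qed

text \<open>By \<open>box_step\<close> it suffices to multiply the generators by some
  \<open>F j = F 0 + (F j - F 0)\<close>. The first summand adds a power of \<open>F 0\<close> and
  keeps \<open>l\<close>; the second raises both the box index and the vanishing order by
  one.\<close>

lemma box_filtration:
  "box m (D * (m + a)) \<subseteq>
    fv.span (\<Union>l\<le>a. (\<lambda>z. F 0 ^ (a - l) * z) ` (box m (D * (m + l)) \<inter> vanish S l))"
proof (induction a)
  case 0
  show ?case
    using box_subset_vanish_0[of m "D * m" S] by (auto intro!: fv.span_base)
next
  case (Suc a)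
  let ?Z = "\<lambda>l. box m (D * (m + l)) \<inter> vanish S l"
  let ?R = "\<lambda>a. \<Union>l\<le>a. (\<lambda>z. F 0 ^ (a - l) * z) ` ?Z l"
  have "F j * f \<in> fv.span (?R (Suc a))" if j: "j \<le> m" and f: "f \<in> box m (D * (m + a))" for j f
  proof (rule mult_span_in_subspace)
    show "f \<in> fv.span (?R a)" using f Suc.IH by blast
    show "fv.subspace (fv.span (?R (Suc a)))" by simp
    fix x assume "x \<in> ?R a"
    then obtain l z where l: "l \<le> a" and z: "z \<in> ?Z l" and x: "x = F 0 ^ (a - l) * z"
      by blast
    let ?z' = "(F j - F 0) * z"
    have "F j * x = F 0 * x + (F j - F 0) * x"
      by (simp add: algebra_simps)
    also have "F 0 * x = F 0 ^ (Suc a - l) * z"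
      using l by (simp add: x Suc_diff_le mult.assoc)
    also have "(F j - F 0) * x = F 0 ^ (Suc a - Suc l) * ?z'"
      by (simp add: x algebra_simps)
    finally have eq: "F j * x = F 0 ^ (Suc a - l) * z + F 0 ^ (Suc a - Suc l) * ?z'" .
    have "?z' \<in> box m (D * (m + Suc l))"
      using z F_mult_in_box[OF j, of z "m + l"] F_mult_in_box[of 0 z "m + l"]
        fv.subspace_diff[OF subspace_box]
      by (simp add: left_diff_distrib)
    moreover have "?z' \<in> vanish S (Suc l)"
      using vanish_mult[OF F_diff_in_vanish[OF j], of z l] z by simp
    ultimately have "F 0 ^ (Suc a - Suc l) * ?z' \<in> ?R (Suc a)"
      using l by blast
    moreover have "F 0 ^ (Suc a - l) * z \<in> ?R (Suc a)"
      using l z by auto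
    ultimately show "F j * x \<in> fv.span (?R (Suc a))"
      unfolding eq by (intro fv.span_add fv.span_base)
  qed
  then have "fv.span (\<Union>j\<le>m. (\<lambda>f. F j * f) ` box m (D * (m + a))) \<subseteq> fv.span (?R (Suc a))"
    by (intro fv.span_minimal) auto
  moreover have "box m (D * (m + Suc a)) \<subseteq> fv.span (\<Union>j\<le>m. (\<lambda>f. F j * f) ` box m (D * (m + a)))"
    using box_step[of m g D "m + a"] coprime degree D_pos by (simp add: F_def)
  ultimately show ?case by blast
qed

text \<open>In \<open>box_filtration\<close>, terms with \<open>l \<le> L\<close> are
  \<open>F 0 ^ (a - L)\<close> times an element of the box of index \<open>m + L\<close>, and terms
  with \<open>l > L\<close> vanish to order \<open>L\<close>. Hence the dimension modulo
  \<open>vanish S L\<close> is bounded independently of \<open>a\<close>.\<close>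

lemma box_modulo_vanish:
  assumes "L \<le> a" "box m (D * (m + L)) \<subseteq> fv.span B" "f \<in> box m (D * (m + a))"
  shows "\<exists>v \<in> fv.span ((\<lambda>z. F 0 ^ (a - L) * z) ` B). f - v \<in> vanish S L"
proof -
  let ?B = "(\<lambda>z. F 0 ^ (a - L) * z) ` B"
  let ?T = "{x + y |x y. x \<in> fv.span ?B \<and> y \<in> vanish S L}"
  have T: "fv.subspace ?T"
    by (intro fv.subspace_sums fv.subspace_span subspace_vanish)
  have "(\<Union>l\<le>a. (\<lambda>z. F 0 ^ (a - l) * z) ` (box m (D * (m + l)) \<inter> vanish S l)) \<subseteq> ?T"
  proof safe
    fix l z assume l: "l \<le> a" and z: "z \<in> box m (D * (m + l))" "z \<in> vanish S l"
    show "\<exists>x y. F 0 ^ (a - l) * z = x + y \<and> x \<in> fv.span ?B \<and> y \<in> vanish S L"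
    proof (cases "l \<le> L")
      case True
      have "F 0 ^ (L - l) * z \<in> box m (D * (m + L))"
        using F_power_mult_in_box[OF z(1), of "L - l"] True by simp
      then have "F 0 ^ (L - l) * z \<in> fv.span B"
        using assms(2) by (rule rev_subsetD)
      then have "F 0 ^ (a - L) * (F 0 ^ (L - l) * z) \<in> fv.span ?B"
        by (rule mult_span_in_subspace) (simp_all add: fv.span_base)
      moreover have "F 0 ^ (a - L) * (F 0 ^ (L - l) * z) = F 0 ^ (a - l) * z"
        using True assms(1) by (simp add: mult.assoc[symmetric] power_add[symmetric])
      moreover have "0 \<in> vanish S L"
        using subspace_vanish by (rule fv.subspace_0)
      ultimately show ?thesis
        by (intro exI[of _ "F 0 ^ (a - l) * z"] exI[of _ 0]) simp
    next
      case False
      have "F 0 ^ (a - l) * z \<in> vanish S l"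
        using vanish_mult[OF F_power_in_vanish z(2)] by simp
      then have "F 0 ^ (a - l) * z \<in> vanish S L"
        by (rule vanish_antimono) (use False in simp)
      then show ?thesis
        using fv.span_zero[of ?B] by (intro exI[of _ 0] exI[of _ "F 0 ^ (a - l) * z"]) simp
    qed
  qed
  then have "f \<in> ?T"
    using fv.span_minimal[OF _ T] box_filtration[of a] assms(3) by (meson subsetD)
  then obtain x y where xy: "f = x + y" "x \<in> fv.span ?B" "y \<in> vanish S L"
    by blast
  have "f - x \<in> vanish S L"
    using xy(1,3) by simp
  then show ?thesis
    using xy(2) by (rule bexI)
qed

text \<open>The functions \<open>u (P, l)\<close> vanish to order \<open>L\<close> at the points other than \<open>P\<close>, and form a basis of
  the jets of order below \<open>L\<close> at \<open>P\<close>. Exponent vectors of degree at most \<open>N\<close> are encoded as lists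
  of length \<open>m + 1\<close> with sum exactly \<open>N\<close>, the last entry being slack.\<close>

lemma independent_modulo_vanish:
  fixes N :: nat
  defines "L \<equiv> N + 1"
  defines "A \<equiv> {l::nat list. length l = m + 1 \<and> sum_list l = N}"
  defines "u \<equiv> \<lambda>(P, l). tens m (\<lambda>i. (if i = 0 then \<Prod>Q\<in>S - {P}. [:- Q 0, 1:] ^ L else 1) * [:- P i, 1:] ^ (l ! i))"
  assumes c: "(\<Sum>x\<in>S \<times> A. fscale (c x) (u x)) \<in> vanish S L"
  shows "\<forall>x\<in>S \<times> A. c x = 0"
proof safe
  fix P l assume P: "P \<in> S" and l: "l \<in> A"
  let ?E0 = "\<lambda>R. \<Prod>Q\<in>S - {R}. [:- Q 0, 1:] ^ L :: 'a poly"
  have finA: "finite A"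
    unfolding A_def by (rule finite_lists_sum_eq)
  have u: "u (R, l) y = poly (?E0 R) (y 0) * (\<Prod>i<m. (y i - R i) ^ (l ! i))" for R l y
  proof -
    have "u (R, l) y = (\<Prod>i<m. poly (if i = 0 then ?E0 R else 1) (y i)) * (\<Prod>i<m. (y i - R i) ^ (l ! i))"
      by (simp add: u_def tens_def prod.distrib)
    also have "(\<Prod>i<m. poly (if i = 0 then ?E0 R else 1) (y i)) = (\<Prod>i<m. if i = 0 then poly (?E0 R) (y 0) else 1)"
      by (rule prod.cong) auto
    also have "\<dots> = poly (?E0 R) (y 0)"
      using m_pos by simp
    finally show ?thesis .
  qed
  have "(\<Sum>l\<in>A. c (P, l) * (\<Prod>i<m. v i ^ (l ! i))) = 0" for v :: "nat \<Rightarrow> 'a"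
  proof -
    let ?y = "\<lambda>\<tau> i. P i + \<tau> * v i"
    define G where "G = (\<Sum>l\<in>A. Polynomial.monom (c (P, l) * (\<Prod>i<m. v i ^ (l ! i))) (\<Sum>i<m. l ! i))"
    define E where "E = pcompose (?E0 P) [:P 0, v 0:]"
    \<comment> \<open>On a line through \<open>P\<close> the factor belonging to \<open>P\<close> in
      \<open>u (Q, l)\<close> becomes \<open>(\<tau> * v 0) ^ L\<close>, so only the functions
      centred at \<open>P\<close> survive modulo order \<open>L\<close>.\<close>
    have "u (Q, l) \<in> vanish {P} L" if "Q \<in> S - {P}" for Q l
      unfolding vanish_def
    proof (safe)
      fix v
      have *: "?E0 Q = [:- P 0, 1:] ^ L * (\<Prod>R\<in>S - {Q} - {P}. [:- R 0, 1:] ^ L)"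
        using that finite_S P by (subst prod.remove[of _ P]) auto
      show "\<exists>h. \<forall>\<tau>. u (Q, l) (\<lambda>i. P i + \<tau> * v i) = \<tau> ^ L * poly h \<tau>"
        by (rule exI[of _ "smult (v 0 ^ L) (pcompose (\<Prod>R\<in>S - {Q} - {P}. [:- R 0, 1:] ^ L) [:P 0, v 0:]
              * (\<Prod>i<m. [:P i - Q i, v i:] ^ (l ! i)))"])
          (simp add: u * poly_pcompose poly_prod power_mult_distrib algebra_simps)
    qed
    then have "(\<Sum>x\<in>(S - {P}) \<times> A. fscale (c x) (u x)) \<in> vanish {P} L"
      by (intro fv.subspace_sum subspace_vanish fv.subspace_scale) auto
    moreover have "(\<Sum>x\<in>S \<times> A. fscale (c x) (u x)) \<in> vanish {P} L"
      using c P by (simp add: vanish_def)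
    ultimately have "(\<Sum>x\<in>S \<times> A. fscale (c x) (u x)) - (\<Sum>x\<in>(S - {P}) \<times> A. fscale (c x) (u x))
        \<in> vanish {P} L"
      using fv.subspace_diff[OF subspace_vanish] by blast
    also have "(\<Sum>x\<in>S \<times> A. fscale (c x) (u x)) =
        (\<Sum>x\<in>(S - {P}) \<times> A. fscale (c x) (u x)) + (\<Sum>x\<in>{P} \<times> A. fscale (c x) (u x))"
      using finite_S finA P by (subst sum.union_disjoint[symmetric]) (auto intro!: sum.cong)
    finally have "(\<Sum>x\<in>{P} \<times> A. fscale (c x) (u x)) \<in> vanish {P} L"
      by simp
    then have "\<exists>h. \<forall>\<tau>. (\<Sum>x\<in>{P} \<times> A. fscale (c x) (u x)) (?y \<tau>) = \<tau> ^ L * poly h \<tau>"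
      unfolding vanish_def by blast
    then obtain h where h: "\<And>\<tau>. (\<Sum>x\<in>{P} \<times> A. fscale (c x) (u x)) (?y \<tau>) = \<tau> ^ L * poly h \<tau>"
      by blast
    \<comment> \<open>Along the line, \<open>E\<close> comes from the separating factor and
      \<open>G\<close> sorts the remaining terms by total degree in \<open>\<tau>\<close>.\<close>
    have "(\<Sum>x\<in>{P} \<times> A. fscale (c x) (u x)) (?y \<tau>) = poly (E * G) \<tau>" for \<tau>
    proof -
      have "(\<Sum>x\<in>{P} \<times> A. fscale (c x) (u x)) (?y \<tau>) = (\<Sum>l\<in>A. c (P, l) * u (P, l) (?y \<tau>))"
      proof -
        have "{P} \<times> A = Pair P ` A" by auto
        then show ?thesis by (simp add: fun_apply sum.reindex inj_on_def)
      qed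
      also have "\<dots> = (\<Sum>l\<in>A. poly E \<tau> * poly (Polynomial.monom (c (P, l) * (\<Prod>i<m. v i ^ (l ! i))) (\<Sum>i<m. l ! i)) \<tau>)"
        by (rule sum.cong) (auto simp: u E_def poly_pcompose poly_monom power_mult_distrib prod.distrib power_sum algebra_simps)
      finally show ?thesis
        by (simp add: G_def poly_sum sum_distrib_left)
    qed
    then have "poly (E * G - Polynomial.monom 1 L * h) \<tau> = 0" for \<tau>
      using h by (simp add: poly_monom)
    then have "{\<tau>. poly (E * G - Polynomial.monom 1 L * h) \<tau> = 0} = UNIV"
      by auto
    then have "E * G - Polynomial.monom 1 L * h = 0"
      using poly_roots_finite infinite_UNIV by metis
    then have dvd: "[:0, 1:] ^ L dvd E * G"
      by (auto simp: monom_altdef)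
    have "poly E 0 \<noteq> 0"
      using P inj finite_S by (auto simp: E_def poly_pcompose poly_prod inj_on_def)
    have "Polynomial.degree G \<le> N"
    proof -
      have "(\<Sum>i<m. l ! i) \<le> N" if "l \<in> A" for l
        using that by (auto simp: A_def sum_list_sum_nth atLeast0LessThan)
      then show ?thesis
        unfolding G_def using finA by (intro degree_sum_le order.trans[OF degree_monom_le]) auto
    qed
    \<comment> \<open>\<open>E\<close> does not vanish at 0, so the whole factor
      \<open>\<tau> ^ L\<close> would have to divide \<open>G\<close>, whose degree is at most
      \<open>N < L\<close>.\<close>
    have "G = 0"
    proof (rule ccontr)
      assume "G \<noteq> 0"
      then have "E * G \<noteq> 0"
        using \<open>poly E 0 \<noteq> 0\<close> by auto
      then have "L \<le> Polynomial.order 0 (E * G)"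
        using dvd order_divides[of 0 L "E * G"] by simp
      also have "\<dots> = Polynomial.order 0 G"
        using order_mult[OF \<open>E * G \<noteq> 0\<close>, of 0] \<open>poly E 0 \<noteq> 0\<close> by (simp add: order_0I)
      also have "\<dots> \<le> Polynomial.degree G"
        by (rule order_degree[OF \<open>G \<noteq> 0\<close>])
      finally show False
        using \<open>Polynomial.degree G \<le> N\<close> by (simp add: L_def)
    qed
    \<comment> \<open>At \<open>\<tau> = 1\<close> the sum over all degrees is recovered.\<close>
    then have "poly G 1 = 0" by simp
    then show ?thesis
      by (simp add: G_def poly_sum poly_monom)
  qed
  from coeffs_zero_if_poly_function_zero[OF infinite_UNIV A_def[THEN meta_eq_to_obj_eq] this l]
  show "c (P, l) = 0" .
qed

text \<open>The left side counts the independent jets at all points of \<open>S\<close>; the right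
  side bounds the number of monomials spanning the box of index \<open>m + N + 1\<close>.\<close>

lemma card_times_choose_le: "card S * ((N + m) choose m) \<le> (D * (m + N + 1) + 1) ^ m"
proof -
  let ?L = "N + 1"
  let ?A = "{l::nat list. length l = m + 1 \<and> sum_list l = N}"
  let ?u = "\<lambda>(P, l). tens m (\<lambda>i. (if i = 0 then \<Prod>Q\<in>S - {P}. [:- Q 0, 1:] ^ ?L else 1) * [:- P i, 1:] ^ (l ! i))"
  \<comment> \<open>Bounds the degree of the jet functions in each variable:
    \<open>(card S - 1) * ?L\<close> from the separating factor and at most \<open>?L\<close> from
    the power at \<open>P\<close>.\<close>
  let ?a = "card S * ?L"
  obtain B :: "((nat \<Rightarrow> 'a) \<Rightarrow> 'a) set" where B: "finite B" "card B \<le> (D * (m + ?L) + 1) ^ m" "box m (D * (m + ?L)) \<subseteq> fv.span B"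
    using box_subset_span_monomials by blast
  let ?B = "(\<lambda>z. F 0 ^ (?a - ?L) * z) ` B"
  have "card (S \<times> ?A) \<le> card ?B"
  proof (rule card_le_if_independent_modulo[where V = "vanish S ?L" and u = ?u])
    show "finite (S \<times> ?A)" using finite_S finite_lists_sum_eq by blast
    show "finite ?B" using B by simp
    show "fv.subspace (vanish S ?L)" by (rule subspace_vanish)
    show "\<forall>x\<in>S \<times> ?A. c x = 0" if "(\<Sum>x\<in>S \<times> ?A. fscale (c x) (?u x)) \<in> vanish S ?L" for c
      using independent_modulo_vanish[OF that] .
    show "\<exists>v\<in>fv.span ?B. ?u x - v \<in> vanish S ?L" if x: "x \<in> S \<times> ?A" for x
    proof (rule box_modulo_vanish[OF _ B(3)])
      obtain P l where Pl: "x = (P, l)" "P \<in> S" "l \<in> ?A" using x by blast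
      then have "card S > 0" using finite_S by (auto simp: card_gt_0_iff)
      then show "?L \<le> ?a" by (cases "card S") auto
      have "?u (P, l) \<in> box m ?a"
        unfolding prod.case
      proof (rule tens_in_box)
        fix i assume i: "i < m"
        have deg: "Polynomial.degree ([:- x, 1:] ^ k) = k" for x :: 'a and k
          by (simp add: degree_power_eq)
        have "Polynomial.degree (\<Prod>Q\<in>S - {P}. [:- Q 0, 1:] ^ ?L) \<le>
            sum (Polynomial.degree \<circ> (\<lambda>Q. [:- Q 0, 1:] ^ ?L)) (S - {P})"
          using finite_S by (intro degree_prod_sum_le) simp
        also have "\<dots> = (card S - 1) * ?L"
          using Pl finite_S by (simp only: o_def deg) simp
        finally have 1: "Polynomial.degree (if i = 0 then \<Prod>Q\<in>S - {P}. [:- Q 0, 1:] ^ ?L else 1) \<le> (card S - 1) * ?L"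
          by auto
        have "Polynomial.degree ([:- P i, 1:] ^ (l ! i)) = l ! i"
          by (simp add: degree_power_eq)
        also have "\<dots> \<le> ?L"
          using member_le_sum_list[of "l ! i" l] Pl i by auto
        finally have "Polynomial.degree ((if i = 0 then \<Prod>Q\<in>S - {P}. [:- Q 0, 1:] ^ ?L else 1) * [:- P i, 1:] ^ (l ! i))
            \<le> (card S - 1) * ?L + ?L"
          using 1 by (intro order.trans[OF degree_mult_le] add_mono)
        also have "\<dots> = ?a"
          using \<open>card S > 0\<close> by (cases "card S") auto
        finally show "Polynomial.degree ((if i = 0 then \<Prod>Q\<in>S - {P}. [:- Q 0, 1:] ^ ?L else 1) * [:- P i, 1:] ^ (l ! i)) \<le> ?a" .
      qed
      moreover have "?a \<le> D * (m + ?a)"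
        using D_pos by (cases D) auto
      ultimately show "?u x \<in> box m (D * (m + ?a))"
        using Pl(1) box_mono by blast
    qed
  qed
  also have "card ?B \<le> card B"
    using B by (simp add: card_image_le)
  also have "card ?A = (N + m) choose N"
    using card_length_sum_list[of "m + 1" N] by simp
  then have "card (S \<times> ?A) = card S * ((N + m) choose m)"
    by (simp add: card_cartesian_product binomial_symmetric[of N "N + m"])
  finally show ?thesis
    using B(2) by (simp add: add.assoc)
qed

theorem card_solutions_le: "card S \<le> fact m * D ^ m"
proof -
  let ?C = "D * (m + 1) + 1"
  have bound: "real (card S) \<le> fact m * (real D + real ?C / real N) ^ m" if N: "N > 0" for N
  proof -
    \<comment> \<open>After division by \<open>N ^ m\<close> the right side of the bound converges
      to \<open>fact m * D ^ m\<close>.\<close>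
    have "N ^ m \<le> fact m * ((N + m) choose m)"
    proof -
      have "real N ^ m = (\<Prod>i=0..<m. real N)"
        by simp
      also have "\<dots> \<le> pochhammer (real N + 1) m"
        unfolding pochhammer_prod by (intro prod_mono) auto
      also have "\<dots> = fact m * real ((N + m) choose m)"
        using pochhammer_same[of m] by (simp add: binomial_gbinomial gbinomial_pochhammer' )
      finally show ?thesis
        by (metis of_nat_fact of_nat_le_iff of_nat_mult of_nat_power)
    qed
    then have "card S * N ^ m \<le> fact m * (card S * ((N + m) choose m))"
      by (simp add: mult.left_commute)
    also have "\<dots> \<le> fact m * (D * N + ?C) ^ m"
      using card_times_choose_le[of N] by (intro mult_left_mono) (auto simp: algebra_simps)
    finally have "real (card S * N ^ m) \<le> real (fact m * (D * N + ?C) ^ m)"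
      by (rule of_nat_mono)
    then have "real (card S) * real N ^ m \<le> fact m * (real D * real N + real ?C) ^ m"
      by (simp only: of_nat_mult of_nat_power of_nat_add of_nat_fact)
    also have "real D * real N + real ?C = (real D + real ?C / real N) * real N"
      using N by (simp add: field_simps)
    finally show ?thesis
      using N by (simp add: power_mult_distrib)
  qed
  have "(\<lambda>N. fact m * (real D + real ?C / real N) ^ m) \<longlonglongrightarrow> fact m * (real D + 0) ^ m"
    by (intro tendsto_intros lim_const_over_n)
  then have "real (card S) \<le> fact m * (real D + 0) ^ m"
    by (rule LIMSEQ_le_const) (use bound in \<open>auto intro!: exI[of _ 1]\<close>)
  then have "real (card S) \<le> real (fact m * D ^ m)"
    by simp
  then show ?thesis
    by (simp only: of_nat_le_iff)
qed

end

section \<open>Norm forms over finite fields\<close>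

text \<open>With \<open>Q = CHAR('a) ^ n\<close>, the polynomial \<open>x ^ Q - x\<close> splits
  into linear factors. Its derivative is \<open>- 1\<close>, so no root is repeated and there are
  exactly \<open>Q\<close> of them.\<close>

lemma card_frobenius_fixed_points:
  fixes n :: nat
  assumes "prime CHAR('a::alg_closed_field)" "n > 0"
  shows "card {x :: 'a. x ^ (CHAR('a) ^ n) = x} = CHAR('a) ^ n"
proof -
  let ?Q = "CHAR('a) ^ n"
  define p :: "'a poly" where "p = Polynomial.monom 1 ?Q - [:0, 1:]"
  have Q: "?Q > 1"
    using assms prime_gt_1_nat by (intro one_less_power) auto
  have n: "n > 0" by fact
  have lead: "Polynomial.coeff p ?Q = 1"
    using Q n by (auto simp: p_def coeff_pCons split: nat.splits)
  have deg: "Polynomial.degree p = ?Q"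
  proof (rule antisym)
    show "Polynomial.degree p \<le> ?Q"
      unfolding p_def using Q by (intro degree_diff_le degree_monom_le) auto
    show "?Q \<le> Polynomial.degree p"
      using lead by (intro le_degree) auto
  qed
  have "p \<noteq> 0" using lead by auto
  obtain R where R0: "size R = Polynomial.degree p"
    "p = smult (lead_coeff p) (\<Prod>x\<in>#R. [:-x, 1:])"
    using alg_closed_imp_factorization[OF \<open>p \<noteq> 0\<close>] by blast
  moreover have "lead_coeff p = 1"
    using lead deg by simp
  ultimately have R: "size R = Polynomial.degree p" "p = (\<Prod>x\<in>#R. [:-x, 1:])"
    by (metis smult_1_left)+
  have "of_nat ?Q = (0 :: 'a)"
    using assms by simp
  then have "pderiv p = - 1"
    using n by (simp add: p_def pderiv_diff pderiv_monom pderiv_pCons one_pCons power_0_left)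
  have simple: "count R x \<le> 1" for x
  proof (rule ccontr)
    assume "\<not> count R x \<le> 1"
    then have "2 \<le> count R x"
      by simp
    then have "replicate_mset 2 x \<subseteq># R"
      unfolding count_le_replicate_mset_subset_eq .
    then obtain R' where "R = replicate_mset 2 x + R'"
      by (metis mset_subset_eq_exists_conv)
    then have "p = [:-x, 1:] * ([:-x, 1:] * (\<Prod>x\<in>#R'. [:-x, 1:]))"
      using R(2) by (simp add: numeral_2_eq_2 mult.assoc)
    then have "poly (pderiv p) x = 0"
      by (simp only: pderiv_mult poly_add poly_mult) simp
    then show False
      using \<open>pderiv p = - 1\<close> by simp
  qed
  have "size R = card (set_mset R)"
  proof -
    have "R = mset_set (set_mset R)"
      using simple by (intro multiset_eqI) (metis count_mset_set(1,3) finite_set_mset not_in_iff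
        le_antisym less_one not_le count_greater_zero_iff)
    then show ?thesis
      by (metis size_mset_set)
  qed
  moreover have "set_mset R = {x. poly p x = 0}"
    unfolding R(2) by (auto simp: poly_prod_mset prod_mset_zero_iff)
  moreover have "poly p x = x ^ ?Q - x" for x
    by (simp add: p_def poly_monom)
  ultimately show ?thesis
    using R(1) deg by simp
qed

lemma coprime_linear_polys:
  fixes a b :: "'a::field"
  assumes "a \<noteq> b"
  shows "coprime [:a, 1:] [:b, 1:]"
proof (rule coprimeI)
  fix r assume "r dvd [:a, 1:]" "r dvd [:b, 1:]"
  then have "r dvd smult (1 / (a - b)) ([:a, 1:] - [:b, 1:])"
    by (intro dvd_smult dvd_diff)
  also have "smult (1 / (a - b)) ([:a, 1:] - [:b, 1:]) = 1"
    using assms by (simp add: one_pCons)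
  finally show "r dvd 1" .
qed

text \<open>The fixed sets of the Frobenius powers are arbitrarily large.\<close>

lemma infinite_UNIV_alg_closed:
  assumes "prime CHAR('a::alg_closed_field)"
  shows "infinite (UNIV :: 'a set)"
proof
  assume fin: "finite (UNIV :: 'a set)"
  have "n < card (UNIV :: 'a set)" if "n > 0" for n
  proof -
    have "n < CHAR('a) ^ n"
      using assms prime_gt_1_nat by (intro power_gt_expt) auto
    also have "\<dots> \<le> card (UNIV :: 'a set)"
      using card_frobenius_fixed_points[OF assms that] card_mono[OF fin] by (metis subset_UNIV)
    finally show ?thesis .
  qed
  from this[of "card (UNIV :: 'a set)"] fin show False
    by (auto simp: card_gt_0_iff)
qed

instance alg_closure :: (field) field_gcd ..

section \<open>Frobenius maps, trace and norm\<close>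

text \<open>With \<open>q0 = p ^ b\<close> and \<open>q = q0 ^ e\<close>, the fields involved are \<open>FF = GF(q ^ m)\<close> and the fixed field
  \<open>GF(q0 ^ (m D))\<close> containing \<open>\<theta>\<close>. The congruence on \<open>e\<close> makes the \<open>q ^ m\<close>-Frobenius act on
  \<open>GF(q0 ^ (m D))\<close> as the \<open>q0 ^ m\<close>-Frobenius, so \<open>\<theta>\<close> has \<open>D\<close> conjugates over \<open>FF\<close>.\<close>

locale norm_forms =
  fixes m d D b e :: nat and \<theta> :: "'a::{alg_closed_field, field_gcd}" and c :: "nat \<Rightarrow> 'a"
  assumes prime_char: "prime CHAR('a)"
    and m_pos: "m > 0" and d_eq: "d = D + 1" and D_pos: "D > 0" and b_pos: "b > 0"
    and e_eq_1: "of_nat e = (1 :: 'a)" and e_cong: "\<exists>e'. e = 1 + D * e'"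
    and \<theta>_fixed: "\<theta> ^ ((CHAR('a) ^ b) ^ (m * D)) = \<theta>"
    and \<theta>_not_fixed: "\<And>l. 0 < l \<Longrightarrow> l < D \<Longrightarrow> \<theta> ^ ((CHAR('a) ^ b) ^ (m * l)) \<noteq> \<theta>"
    and c_inj: "inj_on c {1..d}"
    and c_fixed: "\<And>i. i \<in> {1..d} \<Longrightarrow> c i ^ ((CHAR('a) ^ b) ^ m) = c i"
    and c_nonzero: "\<And>i. i \<in> {1..d} \<Longrightarrow> \<theta> + c i \<noteq> 0"
begin

text \<open>The \<open>k\<close>-th iterate of the \<open>q0\<close>-Frobenius. Thus
  \<open>fr e\<close> is the \<open>q\<close>-Frobenius, with fixed field \<open>GF(q)\<close>, and
  \<open>fr (e * m)\<close> has fixed field \<open>GF(q ^ m)\<close>.\<close>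

definition fr :: "nat \<Rightarrow> 'a \<Rightarrow> 'a" where
  "fr k x = x ^ ((CHAR('a) ^ b) ^ k)"

lemma fr_add: "fr k (x + y) = fr k x + fr k y"
  unfolding fr_def using freshmans_dream'[OF prime_char, of _ "b * k"] by (simp add: power_mult)

lemma fr_mult: "fr k (x * y) = fr k x * fr k y"
  by (simp add: fr_def power_mult_distrib)

lemma fr_divide: "fr k (x / y) = fr k x / fr k y"
  by (simp add: fr_def power_divide)

lemma fr_0 [simp]: "fr k 0 = 0"
  using prime_char by (simp add: fr_def prime_gt_0_nat)

lemma fr_1 [simp]: "fr k 1 = 1"
  by (simp add: fr_def)

lemma fr_zero_left [simp]: "fr 0 x = x"
  by (simp add: fr_def)

lemma fr_sum: "fr k (sum f A) = (\<Sum>a\<in>A. fr k (f a))"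
  by (induction A rule: infinite_finite_induct) (auto simp: fr_add)

lemma fr_prod: "fr k (prod f A) = (\<Prod>a\<in>A. fr k (f a))"
  by (induction A rule: infinite_finite_induct) (auto simp: fr_mult)

lemma fr_fr: "fr k (fr l x) = fr (k + l) x"
  by (simp add: fr_def power_add mult.commute flip: power_mult)

lemma fr_diff: "fr k (x - y) = fr k x - fr k y"
  using fr_add[of k "x - y" y] by simp

lemma fr_eq_0_iff [simp]: "fr k x = 0 \<longleftrightarrow> x = 0"
  using prime_char by (auto simp: fr_def prime_gt_0_nat)

lemma fr_inj [simp]: "fr k x = fr k y \<longleftrightarrow> x = y"
  using fr_diff[of k x y] fr_eq_0_iff[of k "x - y"] by auto

lemma fr_fixed_mult: "fr k x = x \<Longrightarrow> fr (k * j) x = x"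
  by (induction j) (auto simp flip: fr_fr)

lemma e_pos: "e > 0"
  using e_cong by auto

lemma fr_\<theta>: "fr (m * D) \<theta> = \<theta>"
  using \<theta>_fixed by (simp add: fr_def)

lemma fr_c: "i \<in> {1..d} \<Longrightarrow> fr (m * j) (c i) = c i"
  using c_fixed by (intro fr_fixed_mult) (simp add: fr_def)

lemma fr_\<theta>_c: "i \<in> {1..d} \<Longrightarrow> fr (m * D) (\<theta> + c i) = \<theta> + c i"
  by (simp add: fr_add fr_\<theta> fr_c)

text \<open>As \<open>e\<close> is 1 modulo \<open>D\<close>, the exponents \<open>e * m * l\<close>
  and \<open>m * l\<close> differ by a multiple of \<open>m * D\<close>.\<close>

lemma fr_e_eq:
  assumes "fr (m * D) u = u"
  shows "fr (e * m * l) u = fr (m * l) u"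
proof -
  obtain e' where "e = 1 + D * e'" using e_cong by blast
  then have "e * m * l = m * l + (m * D) * (e' * l)"
    by (simp add: algebra_simps)
  then show ?thesis
    using fr_fixed_mult[OF assms, of "e' * l"] by (simp flip: fr_fr)
qed

lemma fr_\<theta>_c_not_fixed:
  assumes "i \<in> {1..d}" "0 < l" "l < D"
  shows "fr (e * m * l) (\<theta> + c i) \<noteq> \<theta> + c i"
  unfolding fr_e_eq[OF fr_\<theta>_c[OF assms(1)]]
  using \<theta>_not_fixed[OF assms(2,3)] assms(1) by (simp add: fr_add fr_c) (simp add: fr_def)

text \<open>A trace that is linear over \<open>GF(q0 ^ (m D))\<close>. Restricting the vertices to its kernel \<open>T\<close> costs only
  a constant factor, and it separates the values of the linear forms from their proper conjugates:
  their traces are the elements \<open>\<theta> + c k\<close>, which differ from all their proper conjugates.\<close>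

definition lam :: "'a \<Rightarrow> 'a" where
  "lam x = (\<Sum>j<e. fr (m * D * j) x)"

lemma lam_0 [simp]: "lam 0 = 0"
  by (simp add: lam_def)

lemma lam_add: "lam (x + y) = lam x + lam y"
  by (simp add: lam_def fr_add sum.distrib)

lemma lam_diff: "lam (x - y) = lam x - lam y"
  by (simp add: lam_def fr_diff sum_subtractf)

lemma lam_sum: "lam (sum f A) = (\<Sum>a\<in>A. lam (f a))"
  by (induction A rule: infinite_finite_induct) (auto simp: lam_add)

lemma lam_scale: "fr (m * D) u = u \<Longrightarrow> lam (u * x) = u * lam x"
  by (simp add: lam_def fr_mult fr_fixed_mult sum_distrib_left)

lemma lam_const: "fr (m * D) u = u \<Longrightarrow> lam u = u"
  by (simp add: lam_def fr_fixed_mult e_eq_1)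

lemma lam_fr: "lam (fr k x) = fr k (lam x)"
  by (simp add: lam_def fr_sum fr_fr add.commute)

definition FF :: "'a set" where
  "FF = {x. fr (e * m) x = x}"

definition T :: "'a set" where
  "T = {x \<in> FF. lam x = 0}"

lemma T_subset_FF: "T \<subseteq> FF"
  by (auto simp: T_def)

lemma lam_T_term:
  assumes "i \<in> {1..d}" "x \<in> T"
  shows "lam (x / (\<theta> + c i)) = 0"
proof -
  have "fr (m * D) (1 / (\<theta> + c i)) = 1 / (\<theta> + c i)"
    using fr_\<theta>_c assms(1) by (simp add: fr_divide)
  then have "lam (1 / (\<theta> + c i) * x) = 1 / (\<theta> + c i) * lam x"
    by (rule lam_scale)
  then show ?thesis
    using assms(2) by (simp add: T_def)
qed

lemma fr_FF: "x \<in> FF \<Longrightarrow> fr (e * m * j) x = x"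
  using fr_fixed_mult[of "e * m" x j] by (simp add: FF_def)

text \<open>Applying \<open>fr (m * D)\<close> shifts the summands cyclically, because
  \<open>fr (m * D * e)\<close> is the identity on \<open>FF\<close>.\<close>

lemma lam_FF: "x \<in> FF \<Longrightarrow> fr (m * D) (lam x) = lam x"
proof -
  assume x: "x \<in> FF"
  have "fr (m * D) (lam x) = (\<Sum>j<e. fr (m * D * Suc j) x)"
    by (simp add: lam_def fr_sum fr_fr)
  also have "\<dots> + fr 0 x = (\<Sum>j<Suc e. fr (m * D * j) x)"
    by (subst sum.lessThan_Suc_shift) (simp add: add.commute)
  also have "\<dots> = lam x + fr (m * D * e) x"
    by (simp add: lam_def)
  also have "fr (m * D * e) x = x"
    using fr_FF[OF x, of D] by (simp add: ac_simps)
  finally show ?thesis by simp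
qed

text \<open>Clearing denominators turns the relation into a polynomial \<open>R\<close> over
  \<open>FF\<close> of degree below \<open>D\<close> with root \<open>\<theta>\<close>. The
  \<open>D\<close> distinct conjugates of \<open>\<theta>\<close> over \<open>FF\<close> are roots
  too, so \<open>R = 0\<close>; evaluation at \<open>- c i\<close> isolates
  \<open>B i\<close>.\<close>

lemma independent_over_FF:
  assumes k: "k \<in> {1..d}" and B: "\<And>i. i \<in> {1..d} - {k} \<Longrightarrow> B i \<in> FF"
    and zero: "(\<Sum>i\<in>{1..d} - {k}. B i / (\<theta> + c i)) = 0"
    and i: "i \<in> {1..d} - {k}"
  shows "B i = 0"
proof -
  let ?I = "{1..d} - {k}"
  define R where "R = (\<Sum>i\<in>?I. smult (B i) (\<Prod>l\<in>?I - {i}. [:c l, 1:]))"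
  have "Polynomial.degree R \<le> D - 1"
    unfolding R_def
  proof (rule degree_sum_le, simp)
    fix i assume i: "i \<in> ?I"
    have "Polynomial.degree (\<Prod>l\<in>?I - {i}. [:c l, 1:]) \<le> (\<Sum>l\<in>?I - {i}. 1)"
      by (rule order.trans[OF degree_prod_sum_le]) auto
    also have "\<dots> = D - 1"
      using i k d_eq by (simp add: card_Diff_subset)
    finally show "Polynomial.degree (smult (B i) (\<Prod>l\<in>?I - {i}. [:c l, 1:])) \<le> D - 1"
      using degree_smult_le order.trans by blast
  qed
  moreover have "D \<le> Polynomial.degree R" if "R \<noteq> 0"
  proof -
    have "poly R \<theta> = (\<Prod>i\<in>?I. \<theta> + c i) * (\<Sum>i\<in>?I. B i / (\<theta> + c i))"
      unfolding R_def poly_sum sum_distrib_left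
    proof (rule sum.cong, simp)
      fix i assume i: "i \<in> ?I"
      then have "(\<Prod>i\<in>?I. \<theta> + c i) = (\<theta> + c i) * (\<Prod>l\<in>?I - {i}. \<theta> + c l)"
        by (intro prod.remove) auto
      then show "poly (smult (B i) (\<Prod>l\<in>?I - {i}. [:c l, 1:])) \<theta> =
          (\<Prod>i\<in>?I. \<theta> + c i) * (B i / (\<theta> + c i))"
        using c_nonzero[of i] i by (simp add: poly_prod add.commute)
    qed
    then have root: "poly R \<theta> = 0" using zero by simp
    have roots: "poly R (fr (e * m * l) \<theta>) = 0" for l
    proof -
      have "poly R (fr (e * m * l) \<theta>) = fr (e * m * l) (poly R \<theta>)"
        unfolding R_def poly_sum fr_sum poly_smult poly_prod fr_mult fr_prod
      proof (intro sum.cong prod.cong arg_cong2[where f = "(*)"] refl)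
        fix i assume "i \<in> ?I"
        then show "B i = fr (e * m * l) (B i)"
          using B fr_FF by simp
      next
        fix i j assume "j \<in> ?I - {i}"
        then show "poly [:c j, 1:] (fr (e * m * l) \<theta>) = fr (e * m * l) (poly [:c j, 1:] \<theta>)"
          using fr_c[of j "e * l"] by (simp add: fr_add ac_simps)
      qed
      then show ?thesis using root by simp
    qed
    have "inj_on (\<lambda>l. fr (e * m * l) \<theta>) {..<D}"
    proof (rule linorder_inj_onI')
      fix l l' assume *: "l \<in> {..<D}" "l' \<in> {..<D}" "l < l'"
      have "fr (e * m * (l' - l)) (\<theta> + c 1) \<noteq> \<theta> + c 1"
        using * d_eq D_pos by (intro fr_\<theta>_c_not_fixed) auto
      then have "fr (e * m * (l' - l)) \<theta> \<noteq> \<theta>"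
        using fr_c[of 1 "e * (l' - l)"] d_eq D_pos by (auto simp: fr_add ac_simps)
      moreover have "fr (e * m * l') \<theta> = fr (e * m * l) (fr (e * m * (l' - l)) \<theta>)"
        using * by (simp add: fr_fr flip: distrib_left)
      ultimately show "fr (e * m * l) \<theta> \<noteq> fr (e * m * l') \<theta>"
        by auto
    qed
    then have "D = card ((\<lambda>l. fr (e * m * l) \<theta>) ` {..<D})"
      by (simp add: card_image)
    also have "\<dots> \<le> card {x. poly R x = 0}"
      using roots that by (intro card_mono poly_roots_finite) auto
    also have "\<dots> \<le> Polynomial.degree R"
      by (rule card_poly_roots_bound[OF that])
    finally show ?thesis .
  qed
  ultimately have "R = 0"
    using d_eq D_pos by fastforce
  then have "0 = poly R (- c i)" by simp
  also have "\<dots> = (\<Sum>j\<in>?I. if j = i then B i * (\<Prod>l\<in>?I - {i}. c l - c i) else 0)"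
    unfolding R_def poly_sum
  proof (rule sum.cong, simp)
    fix j assume j: "j \<in> ?I"
    show "poly (smult (B j) (\<Prod>l\<in>?I - {j}. [:c l, 1:])) (- c i) =
        (if j = i then B i * (\<Prod>l\<in>?I - {i}. c l - c i) else 0)"
      using i j by (auto simp: poly_prod)
  qed
  also have "\<dots> = B i * (\<Prod>l\<in>?I - {i}. c l - c i)"
    using i by simp
  finally have "B i = 0 \<or> (\<Prod>l\<in>?I - {i}. c l - c i) = 0"
    by simp
  moreover have "(\<Prod>l\<in>?I - {i}. c l - c i) \<noteq> 0"
  proof -
    have "c l - c i \<noteq> 0" if "l \<in> ?I - {i}" for l
      using inj_onD[OF c_inj, of l i] that i by fastforce
    then show ?thesis by simp
  qed
  ultimately show ?thesis by blast
qed

text \<open>On \<open>GF(q ^ (m D))\<close> this is the norm to \<open>GF(q)\<close>.\<close>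

definition nrm :: "'a \<Rightarrow> 'a" where
  "nrm x = (\<Prod>r<m * D. fr (e * r) x)"

lemma nrm_mult: "nrm (x * y) = nrm x * nrm y"
  by (simp add: nrm_def fr_mult prod.distrib)

lemma nrm_eq_0_iff [simp]: "nrm x = 0 \<longleftrightarrow> x = 0"
  using m_pos D_pos by (auto simp: nrm_def intro: exI[of _ 0])

lemma nrm_0 [simp]: "nrm 0 = 0"
  by (subst nrm_eq_0_iff) simp

text \<open>Splitting \<open>r = i + m * l\<close> groups the conjugates by their action on
  \<open>FF\<close>: for \<open>y\<close> in \<open>FF\<close> the \<open>i\<close>-th inner product
  involves \<open>y\<close> only through \<open>fr (e * i) y\<close>.\<close>

lemma nrm_eq_double_prod: "nrm x = (\<Prod>i<m. \<Prod>l<D. fr (e * (i + m * l)) x)"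
proof -
  have "nrm x = (\<Prod>l<D. \<Prod>r\<in>{l * m..<l * m + m}. fr (e * r) x)"
    unfolding nrm_def prod.nat_group by (simp add: mult.commute)
  also have "\<dots> = (\<Prod>l<D. \<Prod>i<m. fr (e * (i + m * l)) x)"
  proof (rule prod.cong, simp)
    fix l
    show "(\<Prod>r\<in>{l * m..<l * m + m}. fr (e * r) x) = (\<Prod>i<m. fr (e * (i + m * l)) x)"
      using prod.shift_bounds_nat_ivl[of "\<lambda>r. fr (e * r) x" 0 "l * m" m]
      by (simp add: atLeast0LessThan ac_simps)
  qed
  also have "\<dots> = (\<Prod>i<m. \<Prod>l<D. fr (e * (i + m * l)) x)"
    by (rule prod.swap)
  finally show ?thesis .
qed

lemma nrm_fixed: "fr (e * m * D) x = x \<Longrightarrow> fr e (nrm x) = nrm x"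
proof (cases "x = 0")
  case False
  assume x: "fr (e * m * D) x = x"
  have "fr e (nrm x) = (\<Prod>r<m * D. fr (e * Suc r) x)"
    by (simp add: nrm_def fr_prod fr_fr)
  also have "\<dots> * fr (e * 0) x = (\<Prod>r<Suc (m * D). fr (e * r) x)"
    by (subst prod.lessThan_Suc_shift) (simp add: mult.commute)
  also have "\<dots> = nrm x * fr (e * (m * D)) x"
    by (simp add: nrm_def)
  finally show ?thesis
    using x False by (simp add: mult.assoc)
qed simp

text \<open>Multiplying the form by \<open>\<theta> + c k\<close> gives \<open>y + C x\<close>. The
  norm of this is a product over \<open>i\<close> of polynomials of degree \<open>D\<close> in the
  conjugates of \<open>y\<close>, so the elements of \<open>Y\<close> solve a product
  system.\<close>

lemma card_common_neighbours_le:
  fixes A :: "'j \<Rightarrow> nat \<Rightarrow> 'a"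
  assumes k: "k \<in> {1..d}" and J: "card J = m + 1"
    and A: "\<And>x i. x \<in> J \<Longrightarrow> i \<in> {1..d} - {k} \<Longrightarrow> A x i \<in> T"
    and distinct: "\<And>x x'. x \<in> J \<Longrightarrow> x' \<in> J \<Longrightarrow> x \<noteq> x' \<Longrightarrow> \<exists>i\<in>{1..d} - {k}. A x i \<noteq> A x' i"
    and \<alpha>: "\<And>x. x \<in> J \<Longrightarrow> \<alpha> x \<noteq> 0"
    and Y: "finite Y" "Y \<subseteq> T"
    and eq: "\<And>x y. x \<in> J \<Longrightarrow> y \<in> Y \<Longrightarrow>
      nrm (1 + y / (\<theta> + c k) + (\<Sum>i\<in>{1..d} - {k}. A x i / (\<theta> + c i))) = \<alpha> x * \<beta> y"
  shows "card Y \<le> fact m * D ^ m"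
proof -
  let ?I = "{1..d} - {k}"
  define C where "C x = (\<theta> + c k) * (1 + (\<Sum>i\<in>?I. A x i / (\<theta> + c i)))" for x
  have \<theta>k: "\<theta> + c k \<noteq> 0" "fr (m * D) (\<theta> + c k) = \<theta> + c k"
    using c_nonzero fr_\<theta>_c k by auto
  have lam_C: "lam (C x) = \<theta> + c k" if "x \<in> J" for x
  proof -
    have "lam (A x i / (\<theta> + c i)) = 0" if "i \<in> ?I" for i
      using that A[OF \<open>x \<in> J\<close> that] by (intro lam_T_term) auto
    then show ?thesis
      using \<theta>k by (simp add: C_def lam_scale lam_add lam_sum lam_const)
  qed
  \<comment> \<open>The trace of \<open>C x\<close> is \<open>\<theta> + c k\<close>, which differs
    from its proper conjugates; this forces \<open>l = 0\<close>. Then independence over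
    \<open>FF\<close> recovers all coordinates of \<open>x\<close>.\<close>
  have C_conj: "x = x'" if xx': "x \<in> J" "x' \<in> J" "l < D" "C x = fr (e * m * l) (C x')" for x x' l
  proof (rule ccontr)
    assume "x \<noteq> x'"
    have "\<theta> + c k = fr (e * m * l) (\<theta> + c k)"
      using arg_cong[OF xx'(4), of lam] lam_C[OF xx'(1)] lam_C[OF xx'(2)] by (simp only: lam_fr)
    then have "l = 0"
      using fr_\<theta>_c_not_fixed[OF k _ xx'(3)] by (cases l) auto
    then have "C x = C x'" using xx' by simp
    then have "(\<Sum>i\<in>?I. (A x i - A x' i) / (\<theta> + c i)) = 0"
      using \<theta>k by (simp add: C_def diff_divide_distrib sum_subtractf)
    moreover have "A x i - A x' i \<in> FF" if "i \<in> ?I" for i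
      using A[OF xx'(1) that] A[OF xx'(2) that] by (simp add: T_def FF_def fr_diff)
    ultimately have "A x i - A x' i = 0" if "i \<in> ?I" for i
      using independent_over_FF[OF k, of "\<lambda>i. A x i - A x' i"] that by blast
    then show False
      using distinct[OF xx'(1,2) \<open>x \<noteq> x'\<close>] by auto
  qed
  have "finite J" using J by (metis card.infinite add_is_0 one_neq_zero)
  then obtain f where f: "bij_betw f {..m} J"
    using J finite_same_card_bij[of "{..m}" J] by auto
  \<comment> \<open>The factor \<open>1 / \<alpha> (f j)\<close> sits at \<open>i = 0\<close> only,
    so the product over \<open>i\<close> is divided by it exactly once and its value no longer
    depends on \<open>j\<close>.\<close>
  define g where "g i j = smult (if i = 0 then 1 / \<alpha> (f j) else 1)
      (\<Prod>l<D. [:fr (e * (i + m * l)) (C (f j)), 1:])" for i j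
  let ?S = "(\<lambda>y i. fr (e * i) y) ` Y"
  have fJ: "f j \<in> J" if "j \<le> m" for j
    using f that by (auto simp: bij_betw_def)
  interpret sys: product_system m D g ?S
  proof
    show "m > 0" by (rule m_pos)
    show "D > 0" by (rule D_pos)
    show "finite ?S" using Y by simp
    show "inj_on (\<lambda>P. P 0) ?S" by (auto simp: inj_on_def)
    show "infinite (UNIV :: 'a set)" by (rule infinite_UNIV_alg_closed[OF prime_char])
  next
    fix i j assume "i < m" "j \<le> m"
    have "Polynomial.degree (\<Prod>l<D. [:fr (e * (i + m * l)) (C (f j)), 1:]) =
        (\<Sum>l<D. Polynomial.degree [:fr (e * (i + m * l)) (C (f j)), 1:])"
      by (rule degree_prod_sum_eq) simp
    then show "Polynomial.degree (g i j) = D"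
      using \<alpha>[OF fJ[OF \<open>j \<le> m\<close>]] by (simp add: g_def)
  next
    fix i j j' assume ij: "i < m" "j \<le> m" "j' \<le> m" "j \<noteq> j'"
    \<comment> \<open>For \<open>l \<le> l'\<close> the common Frobenius power cancels and
      \<open>C_conj\<close> applies with \<open>l' - l\<close>; the other order follows by
      exchanging \<open>j\<close> and \<open>j'\<close>.\<close>
    have ne: "fr (e * (i + m * l)) (C (f j)) \<noteq> fr (e * (i + m * l')) (C (f j'))"
      if ll: "l \<le> l'" "l' < D" "j \<le> m" "j' \<le> m" "j \<noteq> j'" for l l' j j'
    proof
      assume *: "fr (e * (i + m * l)) (C (f j)) = fr (e * (i + m * l')) (C (f j'))"
      obtain r where r: "l' = l + r" using ll(1) le_Suc_ex by blast
      have "fr (e * (i + m * l)) (C (f j)) = fr (e * (i + m * l)) (fr (e * m * r) (C (f j')))"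
        unfolding * fr_fr by (simp add: r algebra_simps)
      then have "C (f j) = fr (e * m * r) (C (f j'))" by simp
      then have "f j = f j'"
        by (intro C_conj[of _ _ r] fJ) (use ll r in simp_all)
      then show False
        using f ll(3-5) by (auto simp: bij_betw_def inj_on_def)
    qed
    have "coprime [:fr (e * (i + m * l)) (C (f j)), 1:] [:fr (e * (i + m * l')) (C (f j')), 1:]"
      if "l < D" "l' < D" for l l'
    proof -
      have "fr (e * (i + m * l)) (C (f j)) \<noteq> fr (e * (i + m * l')) (C (f j'))"
        using ne[of l l' j j'] ne[of l' l j' j] that ij by (cases "l \<le> l'") auto
      then show ?thesis
        by (rule coprime_linear_polys)
    qed
    then have "coprime (\<Prod>l<D. [:fr (e * (i + m * l)) (C (f j)), 1:]) (\<Prod>l<D. [:fr (e * (i + m * l)) (C (f j')), 1:])"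
      by (intro prod_coprime_left prod_coprime_right) auto
    then show "coprime (g i j) (g i j')"
      using \<alpha>[OF fJ] ij by (simp add: g_def coprime_def dvd_smult_iff)
  next
    fix P j assume "P \<in> ?S" "j \<le> m"
    then obtain y where y: "y \<in> Y" "P = (\<lambda>i. fr (e * i) y)" by auto
    have "(\<Prod>i<m. poly (g i j) (P i)) = nrm (\<theta> + c k) * \<beta> y" if j: "j \<le> m" for j
    proof -
      have "(\<Prod>i<m. poly (g i j) (P i)) = (\<Prod>i<m. if i = 0 then 1 / \<alpha> (f j) else 1) *
          (\<Prod>i<m. \<Prod>l<D. fr (e * i) y + fr (e * (i + m * l)) (C (f j)))"
        unfolding prod.distrib[symmetric] y(2)
        by (intro prod.cong) (auto simp: g_def poly_prod add.commute)
      also have "(\<Prod>i<m. if i = 0 then 1 / \<alpha> (f j) else 1) = 1 / \<alpha> (f j)"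
        using m_pos by simp
      also have "(\<Prod>i<m. \<Prod>l<D. fr (e * i) y + fr (e * (i + m * l)) (C (f j))) = nrm (y + C (f j))"
        unfolding nrm_eq_double_prod
      proof (intro prod.cong refl)
        fix i l
        have "fr (e * (i + m * l)) y = fr (e * i) (fr (e * m * l) y)"
          by (simp add: fr_fr algebra_simps)
        also have "fr (e * m * l) y = y"
          using y Y T_subset_FF by (intro fr_FF) auto
        finally show "fr (e * i) y + fr (e * (i + m * l)) (C (f j)) = fr (e * (i + m * l)) (y + C (f j))"
          by (simp add: fr_add)
      qed
      also have "y + C (f j) = (\<theta> + c k) * (1 + y / (\<theta> + c k) + (\<Sum>i\<in>?I. A (f j) i / (\<theta> + c i)))"
        using \<theta>k by (simp add: C_def distrib_left)
      also have "nrm \<dots> = nrm (\<theta> + c k) * (\<alpha> (f j) * \<beta> y)"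
        by (simp only: nrm_mult eq[OF fJ[OF j] y(1)])
      finally show ?thesis
        using \<alpha>[OF fJ[OF j]] by simp
    qed
    from this[of j] this[of 0] \<open>j \<le> m\<close>
    show "(\<Prod>i<m. poly (g i j) (P i)) = (\<Prod>i<m. poly (g i 0) (P i))" by simp
  qed
  have "card ?S \<le> fact m * D ^ m"
    by (rule sys.card_solutions_le)
  moreover have "inj_on (\<lambda>y i. fr (e * i) y) Y"
    by (rule inj_onI, drule fun_cong[where x = 0]) simp
  ultimately show ?thesis
    by (simp add: card_image)
qed

end

section \<open>The norm hypergraph\<close>

lemma choice_in_complete_partite:
  assumes "\<And>i. i \<in> {1..d} \<Longrightarrow> x i < s i"
  shows "(\<lambda>i. (i, x i)) ` {1..d} \<in> hedges (complete_partite d s)"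
proof -
  have "((\<lambda>i. (i, x i)) ` {1..d}) \<inter> K_part s i = {(i, x i)}" if "i \<in> {1..d}" for i
    using that assms by (auto simp: K_part_def)
  moreover have "card ((\<lambda>i. (i, x i)) ` {1..d}) = d"
    by (subst card_image) (auto simp: inj_on_def)
  ultimately show ?thesis
    using assms by (auto simp: complete_partite_def K_part_def Let_def)
qed

lemma ex_nat_hypergraph_copy:
  fixes H :: "'a hypergraph"
  assumes "uniform_hypergraph d H"
  obtains H' :: "nat hypergraph" where "uniform_hypergraph d H'"
    "card (hverts H') = card (hverts H)" "card (hedges H') = card (hedges H)"
    "\<And>K :: 'b hypergraph. contains_copy H' K \<Longrightarrow> contains_copy H K"
proof -
  let ?V = "hverts H" and ?E = "hedges H"
  have fin: "finite ?V" and E: "\<And>e. e \<in> ?E \<Longrightarrow> e \<subseteq> ?V \<and> card e = d"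
    using assms by (auto simp: uniform_hypergraph_def)
  obtain f :: "'a \<Rightarrow> nat" where f: "inj_on f ?V"
    using finite_imp_inj_to_nat_seg[OF fin] by blast
  define H' where "H' = (f ` ?V, (\<lambda>e. f ` e) ` ?E)"
  have inj_img: "inj_on (\<lambda>e. f ` e) ?E"
    using E by (intro inj_onI) (auto simp: inj_on_image_eq_iff[OF f])
  show ?thesis
  proof
    show "uniform_hypergraph d H'"
      unfolding uniform_hypergraph_def H'_def using fin E f
      by (auto simp: card_image inj_on_subset image_mono)
    show "card (hverts H') = card ?V"
      using f by (simp add: H'_def card_image)
    show "card (hedges H') = card ?E"
      using inj_img by (simp add: H'_def card_image)
    show "contains_copy H K" if "contains_copy H' K" for K :: "'b hypergraph"
    proof -
      from that obtain \<phi> where \<phi>: "inj_on \<phi> (hverts K)" "\<phi> ` hverts K \<subseteq> f ` ?V"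
        "\<And>e. e \<in> hedges K \<Longrightarrow> \<phi> ` e \<in> (\<lambda>e. f ` e) ` ?E"
        unfolding contains_copy_def H'_def by auto
      let ?g = "the_inv_into ?V f"
      show ?thesis
        unfolding contains_copy_def
      proof (intro exI[of _ "?g \<circ> \<phi>"] conjI ballI)
        show "inj_on (?g \<circ> \<phi>) (hverts K)"
          using \<phi> f by (intro comp_inj_on inj_on_subset[OF inj_on_the_inv_into]) auto
        show "(?g \<circ> \<phi>) ` hverts K \<subseteq> ?V"
          using \<phi>(2) f by (force simp: the_inv_into_f_f)
        fix e assume "e \<in> hedges K"
        from \<phi>(3)[OF this] obtain e' where e': "\<phi> ` e = f ` e'" "e' \<in> ?E"
          by (rule imageE)
        have "(?g \<circ> \<phi>) ` e = ?g ` f ` e'"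
          unfolding image_comp[symmetric] e'(1) ..
        also have "\<dots> = (\<lambda>x. x) ` e'"
          unfolding image_image
          by (rule image_cong) (use E[OF e'(2)] in \<open>auto simp: the_inv_into_f_f[OF f]\<close>)
        also have "\<dots> = e'"
          by simp
        finally show "(?g \<circ> \<phi>) ` e \<in> ?E"
          using e' by simp
      qed
    qed
  qed
qed

section \<open>Vertices and edges of the norm hypergraph\<close>

context norm_forms
begin

text \<open>The multiplicative group of \<open>GF(q)\<close>.\<close>

definition Fqs :: "'a set" where
  "Fqs = {x. fr e x = x \<and> x \<noteq> 0}"

definition is_edge :: "(nat \<Rightarrow> 'a) \<Rightarrow> (nat \<Rightarrow> 'a) \<Rightarrow> bool" where
  "is_edge A a \<longleftrightarrow> (\<forall>i\<in>{1..d}. A i \<in> T \<and> a i \<in> Fqs) \<and>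
     nrm (1 + (\<Sum>i\<in>{1..d}. A i / (\<theta> + c i))) = (\<Prod>i\<in>{1..d}. a i)"

definition edge :: "(nat \<Rightarrow> 'a) \<Rightarrow> (nat \<Rightarrow> 'a) \<Rightarrow> (nat \<times> 'a \<times> 'a) set" where
  "edge A a = (\<lambda>i. (i, A i, a i)) ` {1..d}"

definition norm_hypergraph :: "(nat \<times> 'a \<times> 'a) hypergraph" where
  "norm_hypergraph = ({1..d} \<times> T \<times> Fqs, {edge A a | A a. is_edge A a})"

lemma card_FF: "card FF = (CHAR('a) ^ (b * e)) ^ m"
  using card_frobenius_fixed_points[OF prime_char, of "b * e * m"] b_pos e_pos m_pos
  by (simp add: FF_def fr_def flip: power_mult) (simp add: mult.assoc)

lemma card_Fqs: "card Fqs = CHAR('a) ^ (b * e) - 1"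
proof -
  have card: "card {x. fr e x = x} = CHAR('a) ^ (b * e)"
    using card_frobenius_fixed_points[OF prime_char, of "b * e"] b_pos e_pos
    by (simp add: fr_def flip: power_mult)
  have "Fqs = {x. fr e x = x} - {0}"
    by (auto simp: Fqs_def)
  then show ?thesis
    by (simp add: card card_Diff_singleton)
qed

lemma finite_FF: "finite FF"
proof -
  have "card FF > 0"
    using prime_char by (simp add: card_FF prime_gt_0_nat)
  then show ?thesis by (rule card_ge_0_finite)
qed

lemma finite_T: "finite T"
  using finite_FF T_subset_FF by (rule rev_finite_subset)

lemma finite_Fqs: "finite Fqs"
proof (rule finite_subset)
  show "Fqs \<subseteq> FF"
    by (auto simp: Fqs_def FF_def fr_fixed_mult)
qed (rule finite_FF)

lemma card_T_le: "card T \<le> (CHAR('a) ^ (b * e)) ^ m"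
  using card_mono[OF finite_FF T_subset_FF] by (simp add: card_FF)

lemma card_T_pos: "card T > 0"
proof -
  have "0 \<in> T" by (simp add: T_def FF_def)
  then show ?thesis using finite_T by (auto simp: card_gt_0_iff)
qed

text \<open>\<open>lam\<close> maps \<open>FF\<close> additively into the fixed field of
  \<open>fr (m * D)\<close>, and each nonempty fibre is a translate of \<open>T\<close>. The factor
  lost does not depend on \<open>e\<close>.\<close>

lemma card_T_ge: "(CHAR('a) ^ (b * e)) ^ m \<le> CHAR('a) ^ (b * (m * D)) * card T"
proof -
  let ?E = "{x. fr (m * D) x = x}"
  have card_E: "card ?E = CHAR('a) ^ (b * (m * D))"
    using card_frobenius_fixed_points[OF prime_char, of "b * (m * D)"] b_pos m_pos D_pos
    by (simp add: fr_def flip: power_mult)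
  have "card ?E > 0"
    using prime_char by (simp add: card_E prime_gt_0_nat)
  then have fin_E: "finite ?E" by (rule card_ge_0_finite)
  have fibre: "card {x \<in> FF. lam x = v} \<le> card T" for v
  proof (cases "{x \<in> FF. lam x = v} = {}")
    case True
    show ?thesis unfolding True by simp
  next
    case False
    then obtain x0 where x0: "x0 \<in> FF" "lam x0 = v" by auto
    show ?thesis
    proof (rule card_inj_on_le[OF _ _ finite_T])
      show "inj_on (\<lambda>x. x - x0) {x \<in> FF. lam x = v}" by (auto simp: inj_on_def)
      show "(\<lambda>x. x - x0) ` {x \<in> FF. lam x = v} \<subseteq> T"
        using x0 by (auto simp: T_def FF_def fr_diff lam_diff)
    qed
  qed
  have "FF \<subseteq> (\<Union>v\<in>?E. {x \<in> FF. lam x = v})"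
    using lam_FF by auto
  then have "card FF \<le> card (\<Union>v\<in>?E. {x \<in> FF. lam x = v})"
    using finite_FF fin_E by (intro card_mono) auto
  also have "\<dots> \<le> (\<Sum>v\<in>?E. card {x \<in> FF. lam x = v})"
    by (rule card_UN_le[OF fin_E])
  also have "\<dots> \<le> card ?E * card T"
    using sum_bounded_above[of ?E "\<lambda>v. card {x \<in> FF. lam x = v}" "card T"] fibre by simp
  finally show ?thesis
    by (simp add: card_FF card_E)
qed

lemma mem_edge_iff: "(i, x, y) \<in> edge A a \<longleftrightarrow> i \<in> {1..d} \<and> x = A i \<and> y = a i"
  by (auto simp: edge_def)

lemma fst_edge: "fst ` edge A a = {1..d}"
  by (simp add: edge_def image_image)

lemma uniform_norm_hypergraph: "uniform_hypergraph d norm_hypergraph"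
proof -
  have "card (edge A a) = d" for A a
    unfolding edge_def by (subst card_image) (auto simp: inj_on_def)
  moreover have "edge A a \<subseteq> {1..d} \<times> T \<times> Fqs" if "is_edge A a" for A a
    using that by (auto simp: edge_def is_edge_def)
  ultimately show ?thesis
    using finite_T finite_Fqs unfolding uniform_hypergraph_def norm_hypergraph_def by fastforce
qed

lemma card_hverts: "card (hverts norm_hypergraph) = d * (card T * card Fqs)"
  by (simp add: norm_hypergraph_def card_cartesian_product)

text \<open>The trace of the form is 1, so the form is nonzero; it is fixed by
  \<open>fr (e * m * D)\<close>, so its norm lies in \<open>GF(q)\<close>.\<close>

lemma form_value:
  assumes "\<And>i. i \<in> {1..d} \<Longrightarrow> A i \<in> T"
  shows "nrm (1 + (\<Sum>i\<in>{1..d}. A i / (\<theta> + c i))) \<in> Fqs"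
proof -
  let ?X = "1 + (\<Sum>i\<in>{1..d}. A i / (\<theta> + c i))"
  have "lam (A i / (\<theta> + c i)) = 0" if "i \<in> {1..d}" for i
    using that assms by (intro lam_T_term)
  then have "lam ?X = 1"
    by (simp add: lam_add lam_sum lam_const)
  then have "?X \<noteq> 0"
    using lam_0 by (metis zero_neq_one)
  moreover have "fr (e * m * D) ?X = ?X"
  proof -
    have "fr (e * m * D) (A i / (\<theta> + c i)) = A i / (\<theta> + c i)" if i: "i \<in> {1..d}" for i
    proof -
      have "fr (e * m * D) (A i) = A i"
        using assms[OF i] T_subset_FF by (intro fr_FF) auto
      moreover have "fr (e * m * D) (\<theta> + c i) = \<theta> + c i"
        using fr_e_eq[OF fr_\<theta>_c[OF i], of D] fr_\<theta>_c[OF i] by simp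
      ultimately show ?thesis by (simp add: fr_divide)
    qed
    then show ?thesis by (simp add: fr_add fr_sum)
  qed
  ultimately show ?thesis
    using nrm_fixed[of ?X] by (simp add: Fqs_def)
qed

lemma finite_hedges: "finite (hedges norm_hypergraph)"
proof (rule finite_subset)
  show "hedges norm_hypergraph \<subseteq> Pow (hverts norm_hypergraph)"
    using uniform_norm_hypergraph by (auto simp: uniform_hypergraph_def)
  show "finite (Pow (hverts norm_hypergraph))"
    using uniform_norm_hypergraph by (simp add: uniform_hypergraph_def)
qed

lemma card_hedges_ge: "card T ^ d * card Fqs ^ D \<le> card (hedges norm_hypergraph)"
proof -
  let ?P = "({1..d} \<rightarrow>\<^sub>E T) \<times> ({1..D} \<rightarrow>\<^sub>E Fqs)"
  have set: "{1..d} = insert d {1..D}" "d \<notin> {1..D}"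
    using d_eq by auto
  \<comment> \<open>All \<open>A i\<close> and the first \<open>D\<close> values \<open>a i\<close>
    are free; the edge equation then forces the value at \<open>d\<close>.\<close>
  define ext where "ext A a = a(d := nrm (1 + (\<Sum>i\<in>{1..d}. A i / (\<theta> + c i))) / (\<Prod>i\<in>{1..D}. a i))"
    for A a :: "nat \<Rightarrow> 'a"
  have "card ?P = card T ^ d * card Fqs ^ D"
    by (simp add: card_cartesian_product card_PiE)
  moreover have "card ?P \<le> card (hedges norm_hypergraph)"
  proof (rule card_inj_on_le[OF _ _ finite_hedges])
    show "inj_on (\<lambda>(A, a). edge A (ext A a)) ?P"
    proof (rule inj_onI, clarify)
      fix A a A' a'
      assume A: "A \<in> {1..d} \<rightarrow>\<^sub>E T" "A' \<in> {1..d} \<rightarrow>\<^sub>E T"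
        and a: "a \<in> {1..D} \<rightarrow>\<^sub>E Fqs" "a' \<in> {1..D} \<rightarrow>\<^sub>E Fqs"
        and eq: "edge A (ext A a) = edge A' (ext A' a')"
      have *: "A i = A' i \<and> ext A a i = ext A' a' i" if "i \<in> {1..d}" for i
        using that eq mem_edge_iff[of i "A i" "ext A a i" A "ext A a"]
          mem_edge_iff[of i "A i" "ext A a i" A' "ext A' a'"] by simp
      have "A = A'"
        using A * by (intro PiE_ext[OF A]) blast
      moreover have "a = a'"
      proof (rule PiE_ext[OF a])
        fix i assume "i \<in> {1..D}"
        then show "a i = a' i"
          using *[of i] set by (auto simp: ext_def split: if_splits)
      qed
      ultimately show "A = A' \<and> a = a'" by simp
    qed
    show "(\<lambda>(A, a). edge A (ext A a)) ` ?P \<subseteq> hedges norm_hypergraph"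
    proof clarify
      fix A a assume A: "A \<in> {1..d} \<rightarrow>\<^sub>E T" and a: "a \<in> {1..D} \<rightarrow>\<^sub>E Fqs"
      let ?v = "nrm (1 + (\<Sum>i\<in>{1..d}. A i / (\<theta> + c i)))"
      have v: "?v \<in> Fqs" using A by (intro form_value) auto
      have ai: "a i \<in> Fqs" if "i \<in> {1..D}" for i
        using a that by auto
      have p: "(\<Prod>i\<in>{1..D}. a i) \<in> Fqs"
        using ai by (simp add: Fqs_def fr_prod)
      have "?v / (\<Prod>i\<in>{1..D}. a i) \<in> Fqs"
        using v p by (simp add: Fqs_def fr_divide)
      then have "ext A a d \<in> Fqs"
        by (simp add: ext_def)
      moreover have "ext A a i \<in> Fqs" if "i \<in> {1..D}" for i
        using ai[OF that] that set(2) by (auto simp: ext_def)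
      ultimately have "\<forall>i\<in>{1..d}. ext A a i \<in> Fqs"
        unfolding set(1) by blast
      moreover have "(\<Prod>i\<in>{1..d}. ext A a i) = ?v"
      proof -
        have "(\<Prod>i\<in>{1..D}. ext A a i) = (\<Prod>i\<in>{1..D}. a i)"
          using set(2) by (intro prod.cong) (auto simp: ext_def)
        then have "(\<Prod>i\<in>{1..d}. ext A a i) = ext A a d * (\<Prod>i\<in>{1..D}. a i)"
          by (subst set(1), subst prod.insert) (use set(2) in simp_all)
        then show ?thesis
          using p by (simp add: ext_def Fqs_def)
      qed
      ultimately have "is_edge A (ext A a)"
        using A by (auto simp: is_edge_def)
      then show "edge A (ext A a) \<in> hedges norm_hypergraph"
        by (auto simp: norm_hypergraph_def)
    qed
  qed
  ultimately show ?thesis by simp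
qed

section \<open>Absence of copies\<close>

text \<open>A copy of the complete hypergraph may distribute its parts over the parts of the host in any order.\<close>

lemma permuted:
  assumes "bij_betw \<pi> {1..d} {1..d}"
  shows "norm_forms m d D b e \<theta> (c \<circ> \<pi>)"
proof
  have "\<pi> i \<in> {1..d}" if "i \<in> {1..d}" for i
    using assms that by (rule bij_betw_apply)
  then show "\<And>i. i \<in> {1..d} \<Longrightarrow> (c \<circ> \<pi>) i ^ (CHAR('a) ^ b) ^ m = (c \<circ> \<pi>) i"
    "\<And>i. i \<in> {1..d} \<Longrightarrow> \<theta> + (c \<circ> \<pi>) i \<noteq> 0"
    using c_fixed c_nonzero unfolding o_apply by blast+
  show "inj_on (c \<circ> \<pi>) {1..d}"
    using assms c_inj by (intro comp_inj_on) (auto simp: bij_betw_def)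
qed (fact prime_char m_pos d_eq D_pos b_pos e_eq_1 e_cong \<theta>_fixed \<theta>_not_fixed)+

text \<open>The \<open>m + 1\<close> choices of vertices in the first \<open>D\<close> parts of a
  copy have the \<open>s d\<close> vertices of the last part as common neighbours, more than
  \<open>card_common_neighbours_le\<close> permits.\<close>

theorem norm_hypergraph_free:
  assumes s_pos: "\<And>i. i \<in> {1..d} \<Longrightarrow> s i > 0" and prod_s: "(\<Prod>i=1..D. s i) = m + 1"
    and s_d: "s d > fact m * D ^ m"
  shows "\<not> contains_copy norm_hypergraph (complete_partite d s)"
proof
  assume "contains_copy norm_hypergraph (complete_partite d s)"
  then obtain \<phi> where inj: "inj_on \<phi> (hverts (complete_partite d s))"
    and edges: "\<And>e. e \<in> hedges (complete_partite d s) \<Longrightarrow> \<phi> ` e \<in> hedges norm_hypergraph"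
    unfolding contains_copy_def by blast
  define p A a where "p i r = fst (\<phi> (i, r))" and "A i r = fst (snd (\<phi> (i, r)))"
    and "a i r = snd (snd (\<phi> (i, r)))" for i r :: nat
  have \<phi>_eq: "\<phi> (i, r) = (p i r, A i r, a i r)" for i r
    by (simp add: p_def A_def a_def)
  have edge: "\<exists>A' a'. is_edge A' a' \<and> (\<lambda>i. (p i (x i), A i (x i), a i (x i))) ` {1..d} = edge A' a'"
    if "\<And>i. i \<in> {1..d} \<Longrightarrow> x i < s i" for x
    using edges[OF choice_in_complete_partite[of d x s]] that
    by (auto simp: norm_hypergraph_def image_image \<phi>_eq)
  have p_bij: "bij_betw (\<lambda>i. p i (x i)) {1..d} {1..d}" if x: "\<And>i. i \<in> {1..d} \<Longrightarrow> x i < s i" for x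
  proof -
    obtain A' a' where "(\<lambda>i. (p i (x i), A i (x i), a i (x i))) ` {1..d} = edge A' a'"
      using edge[of x] x by blast
    from arg_cong[OF this, of "image fst"] have "(\<lambda>i. p i (x i)) ` {1..d} = {1..d}"
      by (simp add: image_image fst_edge)
    then show ?thesis
      unfolding bij_betw_def by (auto intro: eq_card_imp_inj_on)
  qed
  define \<pi> where "\<pi> i = p i 0" for i
  have \<pi>_bij: "bij_betw \<pi> {1..d} {1..d}"
    using p_bij[of "\<lambda>_. 0"] s_pos by (simp add: \<pi>_def[abs_def])
  \<comment> \<open>Exchanging only the vertex of part \<open>i\<close> leaves the host parts of the
    others unchanged, and every edge meets each host part once. So each part of the copy lies in one
    host part.\<close>
  have p_eq: "p i r = \<pi> i" if i: "i \<in> {1..d}" and r: "r < s i" for i r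
  proof -
    let ?x = "(\<lambda>_. 0)(i := r)"
    have bij: "bij_betw (\<lambda>j. p j (?x j)) {1..d} {1..d}"
      using s_pos r by (intro p_bij) auto
    then have "p i r \<in> {1..d}"
      using i bij_betwE[OF bij] by fastforce
    then obtain j where j: "j \<in> {1..d}" "\<pi> j = p i r"
      using \<pi>_bij by (metis bij_betw_imp_surj_on imageE)
    have "j = i"
    proof (rule ccontr)
      assume "j \<noteq> i"
      then have "p j (?x j) = p i (?x i)"
        using j by (simp add: \<pi>_def)
      then show False
        using bij i j(1) \<open>j \<noteq> i\<close> unfolding bij_betw_def inj_on_def by blast
    qed
    then show ?thesis using j by simp
  qed
  interpret perm: norm_forms m d D b e \<theta> "c \<circ> \<pi>"
    by (rule permuted[OF \<pi>_bij])
  have sol: "(\<forall>i\<in>{1..d}. A i (x i) \<in> T \<and> a i (x i) \<in> Fqs) \<and>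
      nrm (1 + (\<Sum>i\<in>{1..d}. A i (x i) / (\<theta> + c (\<pi> i)))) = (\<Prod>i\<in>{1..d}. a i (x i))"
    if x: "\<And>i. i \<in> {1..d} \<Longrightarrow> x i < s i" for x
  proof -
    obtain A' a' where is_edge: "is_edge A' a'"
      and eq: "(\<lambda>i. (p i (x i), A i (x i), a i (x i))) ` {1..d} = edge A' a'"
      using edge[of x] x by blast
    have *: "A i (x i) = A' (\<pi> i) \<and> a i (x i) = a' (\<pi> i) \<and> \<pi> i \<in> {1..d}" if i: "i \<in> {1..d}" for i
    proof -
      have "(\<pi> i, A i (x i), a i (x i)) \<in> edge A' a'"
        unfolding eq[symmetric] using i p_eq[OF i x[OF i]] by (intro image_eqI[of _ _ i]) auto
      then show ?thesis
        unfolding mem_edge_iff by blast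
    qed
    have "(\<Sum>i\<in>{1..d}. A i (x i) / (\<theta> + c (\<pi> i))) = (\<Sum>i\<in>{1..d}. A' (\<pi> i) / (\<theta> + c (\<pi> i)))"
      using * by (intro sum.cong) auto
    also have "\<dots> = (\<Sum>i\<in>{1..d}. A' i / (\<theta> + c i))"
      by (rule sum.reindex_bij_betw[OF \<pi>_bij])
    finally have sum: "(\<Sum>i\<in>{1..d}. A i (x i) / (\<theta> + c (\<pi> i))) = (\<Sum>i\<in>{1..d}. A' i / (\<theta> + c i))" .
    have "(\<Prod>i\<in>{1..d}. a i (x i)) = (\<Prod>i\<in>{1..d}. a' (\<pi> i))"
      using * by (intro prod.cong) auto
    also have "\<dots> = (\<Prod>i\<in>{1..d}. a' i)"
      by (rule prod.reindex_bij_betw[OF \<pi>_bij])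
    finally show ?thesis
      unfolding sum using is_edge * by (auto simp: is_edge_def)
  qed
  have mem: "A i r \<in> T \<and> a i r \<in> Fqs" if "i \<in> {1..d}" "r < s i" for i r
  proof -
    have "\<And>j. j \<in> {1..d} \<Longrightarrow> ((\<lambda>_. 0)(i := r)) j < s j"
      using that s_pos by auto
    from conjunct1[OF sol[OF this]] that(1) show ?thesis by force
  qed
  \<comment> \<open>Equal first components give equal forms, hence equal products; cancelling the
    other factors makes the second components equal too, and \<open>\<phi>\<close> is
    injective.\<close>
  have A_inj: "r = r'" if i: "i \<in> {1..d}" and r: "r < s i" "r' < s i" and eq: "A i r = A i r'" for i r r'
  proof -
    let ?x = "\<lambda>r. (\<lambda>_. 0)(i := r)"
    have x: "\<And>j. j \<in> {1..d} \<Longrightarrow> ?x r j < s j" "\<And>j. j \<in> {1..d} \<Longrightarrow> ?x r' j < s j"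
      using r s_pos by auto
    have "(\<Sum>j\<in>{1..d}. A j (?x r j) / (\<theta> + c (\<pi> j))) = (\<Sum>j\<in>{1..d}. A j (?x r' j) / (\<theta> + c (\<pi> j)))"
      using eq by (intro sum.cong) auto
    then have "(\<Prod>j\<in>{1..d}. a j (?x r j)) = (\<Prod>j\<in>{1..d}. a j (?x r' j))"
      using sol[OF x(1)] sol[OF x(2)] by metis
    moreover have "(\<Prod>j\<in>{1..d}. a j (?x r j)) = a i r * (\<Prod>j\<in>{1..d} - {i}. a j 0)" for r
    proof -
      have "(\<Prod>j\<in>{1..d}. a j (?x r j)) = a i (?x r i) * (\<Prod>j\<in>{1..d} - {i}. a j (?x r j))"
        using i by (intro prod.remove) auto
      also have "(\<Prod>j\<in>{1..d} - {i}. a j (?x r j)) = (\<Prod>j\<in>{1..d} - {i}. a j 0)"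
        by (intro prod.cong) auto
      finally show ?thesis by simp
    qed
    moreover have "(\<Prod>j\<in>{1..d} - {i}. a j 0) \<noteq> 0"
      using mem s_pos by (auto simp: Fqs_def)
    ultimately have "a i r = a i r'" by simp
    then have "\<phi> (i, r) = \<phi> (i, r')"
      using eq p_eq i r by (simp add: \<phi>_eq)
    moreover have "(i, r) \<in> hverts (complete_partite d s)" "(i, r') \<in> hverts (complete_partite d s)"
      using i r by (auto simp: complete_partite_def K_part_def Let_def)
    ultimately show ?thesis
      using inj_onD[OF inj] by blast
  qed
  have set: "{1..d} - {d} = {1..D}" "d \<in> {1..d}" "{1..D} \<subseteq> {1..d}"
    using d_eq by auto
  define J where "J = (\<Pi>\<^sub>E i\<in>{1..D}. {..<s i})"
  \<comment> \<open>By \<open>A_inj\<close> a vertex of the last part is determined by its first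
    component, so its second component is a function of \<open>y\<close>.\<close>
  define \<beta> where "\<beta> y = a d (the_inv_into {..<s d} (A d) y)" for y
  have inj_Ad: "inj_on (A d) {..<s d}"
    using A_inj set(2) by (auto simp: inj_on_def)
  have "card (A d ` {..<s d}) \<le> fact m * D ^ m"
  proof (rule perm.card_common_neighbours_le[where k = d and J = J and A = "\<lambda>x i. A i (x i)"
        and \<alpha> = "\<lambda>x. \<Prod>i\<in>{1..D}. a i (x i)" and \<beta> = \<beta>])
    show "d \<in> {1..d}" by fact
    show "card J = m + 1"
      unfolding J_def using prod_s by (simp add: card_PiE)
    show "finite (A d ` {..<s d})" by simp
    show "A d ` {..<s d} \<subseteq> T" using mem[OF set(2)] by auto
  next
    fix x i assume "x \<in> J" "i \<in> {1..d} - {d}"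
    then show "A i (x i) \<in> T"
      using mem[of i "x i"] unfolding set(1) J_def by (fastforce simp: d_eq)
  next
    fix x x' assume xx': "x \<in> J" "x' \<in> J" "x \<noteq> x'"
    then obtain i where i: "i \<in> {1..D}" "x i \<noteq> x' i"
      unfolding J_def by (meson PiE_ext)
    then have "A i (x i) \<noteq> A i (x' i)"
      using A_inj[of i "x i" "x' i"] xx' set(3) unfolding J_def by (auto simp: PiE_iff)
    then show "\<exists>i\<in>{1..d} - {d}. A i (x i) \<noteq> A i (x' i)"
      using i unfolding set(1) by blast
  next
    fix x assume x: "x \<in> J"
    have "a i (x i) \<noteq> 0" if "i \<in> {1..D}" for i
      using mem[of i "x i"] that x set(3) unfolding J_def by (auto simp: PiE_iff Fqs_def)
    then show "(\<Prod>i\<in>{1..D}. a i (x i)) \<noteq> 0" by simp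
  next
    fix x y assume x: "x \<in> J" and y: "y \<in> A d ` {..<s d}"
    then obtain z where z: "z < s d" "y = A d z" by auto
    have \<beta>: "\<beta> y = a d z"
      using z the_inv_into_f_f[OF inj_Ad, of z] by (simp add: \<beta>_def)
    let ?x = "x(d := z)"
    have ins: "{1..d} = insert d {1..D}" "d \<notin> {1..D}" using d_eq by auto
    have "?x i < s i" if "i \<in> {1..d}" for i
      using that x z unfolding ins(1) J_def by (auto simp: PiE_iff)
    from conjunct2[OF sol[OF this]]
    have "nrm (1 + (\<Sum>i\<in>insert d {1..D}. A i (?x i) / (\<theta> + c (\<pi> i)))) =
        (\<Prod>i\<in>insert d {1..D}. a i (?x i))"
      unfolding ins(1) by simp
    moreover have "(\<Sum>i\<in>{1..D}. A i (?x i) / (\<theta> + c (\<pi> i))) = (\<Sum>i\<in>{1..D}. A i (x i) / (\<theta> + c (\<pi> i)))"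
      using ins(2) by (intro sum.cong) auto
    moreover have "(\<Prod>i\<in>{1..D}. a i (?x i)) = (\<Prod>i\<in>{1..D}. a i (x i))"
      using ins(2) by (intro prod.cong) auto
    ultimately show "nrm (1 + y / (\<theta> + (c \<circ> \<pi>) d) +
        (\<Sum>i\<in>{1..d} - {d}. A i (x i) / (\<theta> + (c \<circ> \<pi>) i))) = (\<Prod>i\<in>{1..D}. a i (x i)) * \<beta> y"
      unfolding set(1) using ins(2) by (simp add: z(2) \<beta>[unfolded z(2)] add.assoc mult.commute)
  qed
  then show False
    using s_d inj_Ad by (simp add: card_image)
qed

end

section \<open>Choice of parameters and final estimate\<close>

lemma CHAR_bit [simp]: "CHAR(bit) = 2"
proof (rule CHAR_eqI)
  show "of_nat 2 = (0 :: bit)" by simp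
  show "2 dvd n" if "of_nat n = (0 :: bit)" for n
    using that by (cases "even n") (auto elim: oddE)
qed

lemma sum_power_less:
  fixes B :: nat
  assumes "B \<ge> 2"
  shows "(\<Sum>l<n. B ^ l) < B ^ n"
proof (induction n)
  case (Suc n)
  have "(\<Sum>l<Suc n. B ^ l) < 2 * B ^ n"
    using Suc by simp
  also have "\<dots> \<le> B ^ Suc n"
    using assms by simp
  finally show ?case .
qed simp

lemma fact_mult_power_le: "D > 0 \<Longrightarrow> fact m * D ^ m \<le> (fact (D * m) :: nat)"
proof (induction m)
  case (Suc m)
  have "fact (Suc m) * D ^ Suc m = (D * Suc m) * (fact m * D ^ m)"
    by (simp add: algebra_simps)
  also have "\<dots> \<le> (D * Suc m) * fact (D * m)"
    using Suc by (intro mult_left_mono) auto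
  also have "\<dots> \<le> (D * Suc m) * fact (D * Suc m - 1)"
    using Suc.prems by (intro mult_left_mono fact_mono) auto
  also have "\<dots> = fact (D * Suc m)"
    using Suc.prems fact_reduce[of "D * Suc m", where 'a = nat] by simp
  finally show ?case .
qed simp

text \<open>One choice of \<open>\<theta>\<close> and \<open>c\<close> serves every
  \<open>k\<close>, which keeps the constants uniform. In characteristic 2 the odd number
  \<open>1 + 2 * D * k\<close> is 1 in the field, and it is 1 modulo \<open>D\<close>.\<close>

lemma ex_norm_forms:
  assumes "m > 0" "D > 0"
  shows "\<exists>(\<theta> :: bit alg_closure) c. \<forall>k. norm_forms m (D + 1) D (D + 1) (1 + 2 * D * k) \<theta> c"
proof -
  define q :: nat where "q = 2 ^ (D + 1)"
  let ?Fix = "\<lambda>l. {x :: bit alg_closure. x ^ (q ^ l) = x}"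
  have char: "CHAR(bit alg_closure) = 2"
    by (simp add: CHAR_bit)
  then have prime: "prime CHAR(bit alg_closure)"
    by simp
  have card: "card (?Fix l) = q ^ l" if "l > 0" for l
    using card_frobenius_fixed_points[OF prime, of "(D + 1) * l"] that
    unfolding char power_mult q_def[symmetric] by simp
  have fin: "finite (?Fix l)" if "l > 0" for l
    using card[OF that] by (intro card_ge_0_finite) (simp add: q_def)
  \<comment> \<open>The fixed fields for \<open>l < D\<close> are together too small to cover the
    one for \<open>D\<close>, by a geometric sum.\<close>
  have "\<exists>\<theta>. \<theta> \<in> ?Fix (m * D) \<and> (\<forall>l. 0 < l \<and> l < D \<longrightarrow> \<theta> \<notin> ?Fix (m * l))"
  proof (rule ccontr)
    assume none: "\<not> ?thesis"
    have "?Fix (m * D) \<subseteq> (\<Union>l\<in>{1..<D}. ?Fix (m * l))"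
    proof
      fix x assume "x \<in> ?Fix (m * D)"
      then obtain l where "0 < l" "l < D" "x \<in> ?Fix (m * l)"
        using none by blast
      then show "x \<in> (\<Union>l\<in>{1..<D}. ?Fix (m * l))"
        by (intro UN_I[of l]) auto
    qed
    then have "card (?Fix (m * D)) \<le> card (\<Union>l\<in>{1..<D}. ?Fix (m * l))"
      using fin assms by (intro card_mono finite_UN_I) auto
    also have "\<dots> \<le> (\<Sum>l\<in>{1..<D}. card (?Fix (m * l)))"
      by (rule card_UN_le) simp
    also have "\<dots> = (\<Sum>l\<in>{1..<D}. (q ^ m) ^ l)"
    proof (rule sum.cong)
      fix l assume "l \<in> {1..<D}"
      then show "card (?Fix (m * l)) = (q ^ m) ^ l"
        using card[of "m * l"] assms(1) unfolding power_mult[of q m l, symmetric] by simp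
    qed simp
    also have "\<dots> \<le> (\<Sum>l<D. (q ^ m) ^ l)"
      by (intro sum_mono2) auto
    also have "\<dots> < (q ^ m) ^ D"
    proof (rule sum_power_less)
      have "(2::nat) ^ 1 \<le> 2 ^ ((D + 1) * m)"
        using assms by (intro power_increasing) auto
      then show "2 \<le> q ^ m"
        by (simp only: power_mult power_one_right q_def)
    qed
    finally show False
      using card[of "m * D"] assms unfolding power_mult[of q m D, symmetric] by simp
  qed
  then obtain \<theta> where \<theta>: "\<theta> \<in> ?Fix (m * D)" "\<And>l. 0 < l \<Longrightarrow> l < D \<Longrightarrow> \<theta> \<notin> ?Fix (m * l)"
    by blast
  \<comment> \<open>The exponent \<open>D + 1\<close> in \<open>q\<close> leaves room for
    \<open>D + 1\<close> values of \<open>c\<close>; removing \<open>- \<theta>\<close> keeps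
    \<open>\<theta> + c i\<close> nonzero.\<close>
  have "D + 1 \<le> card (?Fix m - {- \<theta>})"
  proof -
    have "D + 1 < q"
      unfolding q_def by (rule less_exp)
    also have "\<dots> \<le> q ^ m"
      using assms by (intro self_le_power) (auto simp: q_def)
    finally show ?thesis
      using card[OF assms(1)] fin[OF assms(1)] by (auto simp: card_Diff_singleton_if)
  qed
  then obtain C where C: "C \<subseteq> ?Fix m - {- \<theta>}" "card C = D + 1" "finite C"
    by (rule obtain_subset_with_card_n)
  then obtain c where c: "bij_betw c {1..D + 1} C"
    using finite_same_card_bij[of "{1..D + 1}" C] by auto
  have cC: "c i \<in> C" if "i \<in> {1..D + 1}" for i
    using c that by (rule bij_betw_apply)
  have "norm_forms m (D + 1) D (D + 1) (1 + 2 * D * k) \<theta> c" for k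
  proof
    show "of_nat (1 + 2 * D * k) = (1 :: bit alg_closure)"
    proof -
      have "(2 :: bit alg_closure) = 0"
        using of_nat_CHAR[where 'a = "bit alg_closure"] char by simp
      then show ?thesis by simp
    qed
    show "\<exists>e'. 1 + 2 * D * k = 1 + D * e'"
      by (intro exI[of _ "2 * k"]) simp
    show "\<theta> ^ (CHAR(bit alg_closure) ^ (D + 1)) ^ (m * D) = \<theta>"
      using \<theta>(1) unfolding char q_def[symmetric] by simp
    show "\<theta> ^ (CHAR(bit alg_closure) ^ (D + 1)) ^ (m * l) \<noteq> \<theta>" if "0 < l" "l < D" for l
      using \<theta>(2)[OF that] unfolding char q_def[symmetric] by simp
    show "inj_on c {1..D + 1}"
      using c by (simp add: bij_betw_def)
    show "c i ^ (CHAR(bit alg_closure) ^ (D + 1)) ^ m = c i" if "i \<in> {1..D + 1}" for i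
      using cC[OF that] C(1) unfolding char q_def[symmetric] by blast
    show "\<theta> + c i \<noteq> 0" if "i \<in> {1..D + 1}" for i
      using cC[OF that] C(1) by (metis DiffD2 insertI1 minus_unique subsetD)
  qed (use assms prime in auto)
  then show ?thesis by blast
qed

theorem theorem1p2:
  fixes d :: nat and s :: "nat \<Rightarrow> nat"
  assumes "d \<ge> 2"
    and "\<forall>i\<in>{1..d}. s i \<ge> 2"
    and "s d \<ge> fact ((d - 1) * ((\<Prod>i=1..d - 1. s i) - 1)) + 1"
  shows "\<exists>c::real. c > 0 \<and>
    (\<forall>M::nat. \<exists>N\<ge>M. \<exists>H :: nat hypergraph.
       uniform_hypergraph d H \<and> card (hverts H) = N \<and>
       \<not> contains_copy H (complete_partite d s) \<and>
       real (card (hedges H)) \<ge>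
         c * real N powr (real d - 1 / real (\<Prod>i=1..d - 1. s i)))"
proof -
  define D where "D = d - 1"
  define t where "t = (\<Prod>i=1..D. s i)"
  define m where "m = t - 1"
  have d: "d = D + 1" and "D > 0"
    using assms(1) by (auto simp: D_def)
  have "(\<Prod>i=1..D. 2) \<le> t"
    unfolding t_def using assms(2) d by (intro prod_mono) auto
  moreover have "(2::nat) ^ 1 \<le> 2 ^ D"
    using \<open>D > 0\<close> by (intro power_increasing) auto
  ultimately have "t \<ge> 2"
    by simp
  then have t: "t = m + 1" and "m > 0"
    by (auto simp: m_def)
  have s_d: "s d > fact m * D ^ m"
    using fact_mult_power_le[OF \<open>D > 0\<close>, of m] assms(3)
    unfolding D_def[symmetric] t_def[symmetric] m_def[symmetric] by linarith
  obtain \<theta> :: "bit alg_closure" and c where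
    nf: "\<And>k. norm_forms m (D + 1) D (D + 1) (1 + 2 * D * k) \<theta> c"
    using ex_norm_forms[OF \<open>m > 0\<close> \<open>D > 0\<close>] by blast
  have char: "CHAR(bit alg_closure) = 2"
    by (simp add: CHAR_bit)
  define Z where "Z = (2::nat) ^ (d * (m * D))"
  define r where "r = real d - 1 / real t"
  \<comment> \<open>\<open>Z ^ d\<close> pays for restricting \<open>FF\<close> to \<open>T\<close>,
    \<open>2 ^ D\<close> for replacing \<open>q - 1\<close> by \<open>q / 2\<close>, and
    \<open>d powr r\<close> for the factor \<open>d\<close> in the number of vertices.\<close>
  define C where "C = 1 / (real Z ^ d * 2 ^ D * real d powr r)"
  have "r \<ge> 0"
  proof -
    have "1 / real t \<le> 1"
      using \<open>t \<ge> 2\<close> by simp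
    then show ?thesis
      using assms(1) by (simp add: r_def)
  qed
  have "C > 0"
    using assms(1) by (simp add: C_def Z_def)
  moreover have "\<exists>N\<ge>M. \<exists>H :: nat hypergraph.
       uniform_hypergraph d H \<and> card (hverts H) = N \<and>
       \<not> contains_copy H (complete_partite d s) \<and>
       real (card (hedges H)) \<ge> C * real N powr r" for M
  proof -
    define e where "e = 1 + 2 * D * M"
    interpret norm_forms m d D d e \<theta> c
      using nf[of M] by (simp add: d e_def)
    define q where "q = (2::nat) ^ (d * e)"
    have card_Fqs: "card Fqs = q - 1"
      using card_Fqs by (simp add: char q_def)
    have T_le: "card T \<le> q ^ m" and T_ge: "q ^ m \<le> Z * card T"
      using card_T_le card_T_ge by (simp_all add: char q_def Z_def)
    have "M + 1 \<le> d * e"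
    proof -
      have "M \<le> D * M" using \<open>D > 0\<close> by simp
      then have "M + 1 \<le> e" by (simp add: e_def)
      also have "\<dots> \<le> d * e" using d by simp
      finally show ?thesis .
    qed
    then have q_gt: "M + 1 < q"
      unfolding q_def using less_exp order_le_less_trans by blast
    define N where "N = card (hverts norm_hypergraph)"
    have N: "N = d * (card T * (q - 1))"
      by (simp add: N_def card_hverts card_Fqs)
    have "M \<le> q - 1" using q_gt by simp
    also have "\<dots> \<le> N"
    proof -
      have "1 * (1 * (q - 1)) \<le> d * (card T * (q - 1))"
        using card_T_pos d by (intro mult_le_mono) auto
      then show ?thesis by (simp add: N)
    qed
    finally have "M \<le> N" .
    obtain H :: "nat hypergraph" where H: "uniform_hypergraph d H" "card (hverts H) = N"
      "card (hedges H) = card (hedges norm_hypergraph)"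
      "contains_copy H (complete_partite d s) \<Longrightarrow> contains_copy norm_hypergraph (complete_partite d s)"
      using ex_nat_hypergraph_copy[OF uniform_norm_hypergraph] unfolding N_def by metis
    have "\<not> contains_copy norm_hypergraph (complete_partite d s)"
    proof (rule norm_hypergraph_free)
      show "s i > 0" if "i \<in> {1..d}" for i using assms(2) that by fastforce
      show "(\<Prod>i=1..D. s i) = m + 1" using t by (simp add: t_def)
    qed (rule s_d)
    then have free: "\<not> contains_copy H (complete_partite d s)"
      using H(4) by blast
    have "N \<le> d * q ^ t"
    proof -
      have "card T * (q - 1) \<le> q ^ m * q"
        using T_le by (intro mult_mono) auto
      then show ?thesis by (simp add: N t mult.commute)
    qed
    then have "real N \<le> real d * real q ^ t"
      by (metis of_nat_le_iff of_nat_mult of_nat_power)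
    then have "real N powr r \<le> (real d * real q ^ t) powr r"
      using \<open>r \<ge> 0\<close> by (intro powr_mono2) auto
    also have "\<dots> = real d powr r * (real q ^ t) powr r"
      by (simp add: powr_mult)
    also have "(real q ^ t) powr r = real q powr (real t * r)"
      using q_gt by (simp add: powr_powr flip: powr_realpow)
    \<comment> \<open>With \<open>t = m + 1\<close> this is \<open>t * d - 1\<close>, the exponent
      of \<open>q\<close> in the edge count.\<close>
    also have "real t * r = real (m * d + D)"
      using t d by (simp add: r_def field_simps)
    also have "real q powr \<dots> = real q ^ (m * d + D)"
      using q_gt by (intro powr_realpow) simp
    finally have "C * real N powr r \<le> C * (real d powr r * real q ^ (m * d + D))"
      using \<open>C > 0\<close> by (intro mult_left_mono) auto
    also have "\<dots> = real q ^ (m * d + D) / (real Z ^ d * 2 ^ D)"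
      using assms(1) by (simp add: C_def)
    also have "\<dots> = (real q ^ m / real Z) ^ d * (real q / 2) ^ D"
      by (simp add: power_add power_mult power_divide)
    also have "\<dots> \<le> real (card T) ^ d * real (q - 1) ^ D"
    proof (intro mult_mono power_mono)
      have "real q ^ m \<le> real Z * real (card T)"
        using T_ge by (metis of_nat_le_iff of_nat_mult of_nat_power)
      then show "real q ^ m / real Z \<le> real (card T)"
        by (simp add: Z_def divide_le_eq mult.commute)
      show "real q / 2 \<le> real (q - 1)"
        using q_gt by (simp add: of_nat_diff)
    qed auto
    also have "\<dots> \<le> real (card (hedges H))"
      using card_hedges_ge unfolding H(3) card_Fqs
      by (metis of_nat_le_iff of_nat_mult of_nat_power)
    finally show ?thesis
      using H(1,2) free \<open>M \<le> N\<close> by blast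
  qed
  ultimately show ?thesis
    unfolding r_def t_def D_def by blast
qed

end
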